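(* Let $K$ be a field and let $E$ be a row-finite directed graph. If $E$ has a maximal sink with finitely many predecessors or a maximal cycle with finitely many predecessors, then the Leavitt path algebra $L_K(E)$ (with its standard $\mathbb{Z}$-grading) has gr-IBN.
   Context: A directed graph $E=(E^0,E^1,s,r)$ consists of disjoint sets $E^0$ (vertices) and $E^1$ (edges) with maps $s,r:E^1\to E^0$ (source, range). It is row-finite if $|s^{-1}(v)|<\infty$ for all $v\in E^0$. A sink is a vertex $v$ with $s^{-1}(v)=\emptyset$; a vertex $v$ is regular if $0<|s^{-1}(v)|<\infty$. A path is a sequence of edges $p=e_1\cdots e_n$ with $r(e_i)=s(e_{i+1})$; $s(p)=s(e_1)$, $r(p)=r(e_n)$. A closed path ($s(p)=r(p)$) whose vertices $s(e_1),\dots,s(e_n)$ are distinct is a cycle. Write $w\ge v$ if there is a path from $w$ to $v$. For a cycle $c$ and a sink $v$, write $c\Rightarrow v$ if there is a path starting at a vertex of $c$ and ending at $v$; for cycles $d,c$ write $d\Rightarrow c$ if there is a path starting at a vertex of $d$ and ending at a vertex of $c$. A sink $v$ is maximal if there is no cycle $c$ with $c\Rightarrow v$. A cycle $c$ is maximal if there is no cycle $d$, different from every cyclic permutation of $c$, with $d\Rightarrow c$. The predecessors of a vertex $v$ form the set $\{w\in E^0\mid w\ge v\}$, and the predecessors of a cycle $c$ are the predecessors of any vertex on $c$. The Leavitt path algebra $L_K(E)$ is the (possibly non-unital) $K$-algebra generated by $E^0\cup E^1\cup\{e^*\mid e\in E^1\}$ subject to, for all $v,w\in E^0$ and $e,f\in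 E^1$: (1) $vw=\delta_{v,w}w$; (2) $s(e)e=e=er(e)$ and $r(e)e^*=e^*=e^*s(e)$; (3) $e^*f=\delta_{e,f}r(e)$; (4) $v=\sum_{e\in s^{-1}(v)}ee^*$ for every regular vertex $v$. It is $\mathbb{Z}$-graded with $\deg v=0$, $\deg e=1$, $\deg e^*=-1$. For an abelian group $\Gamma$, a $\Gamma$-graded ring $R$ (possibly without unit) and $\delta\in\Gamma$, the shifted graded right module $R(\delta)$ has components $R(\delta)_\gamma=R_{\delta+\gamma}$; $\cong_{gr}$ denotes isomorphism of right modules preserving degrees. $R$ has gr-IBN (Graded Invariant Basis Number) if for all positive integers $m,n$ and all $\alpha_1,\dots,\alpha_m,\beta_1,\dots,\beta_n\in\Gamma$, $R(\alpha_1)\oplus\cdots\oplus R(\alpha_m)\cong_{gr}R(\beta_1)\oplus\cdots\oplus R(\beta_n)$ as graded right $R$-modules implies $m=n$. *)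

theory Defs
  imports
    "HOL-Algebra.QuotRing"
    "HOL-Algebra.Module"
    "HOL-Library.Poly_Mapping"
    "Graph_Theory.Arc_Walk"
begin

section \<open>Row-finite graphs, maximal sinks and maximal cycles\<close>

text \<open>
  A directed graph \<open>(E\<^sup>0, E\<^sup>1, s, r)\<close> is a \<open>pre_digraph\<close> record satisfying \<^locale>\<open>wf_digraph\<close>,
  with \<open>s\<close> = \<^const>\<open>tail\<close> and \<open>r\<close> = \<^const>\<open>head\<close>; the set \<open>s\<inverse>(v)\<close> is \<^term>\<open>out_arcs E v\<close>.
  Paths are the arc lists of \<^const>\<open>pre_digraph.awalk\<close>. These include paths of length 0, so
  every vertex is among its own predecessors.
\<close>

definition row_finite :: "('v, 'e) pre_digraph \<Rightarrow> bool" where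
  "row_finite E \<longleftrightarrow> (\<forall>v \<in> verts E. finite (out_arcs E v))"

definition sink :: "('v, 'e) pre_digraph \<Rightarrow> 'v \<Rightarrow> bool" where
  "sink E v \<longleftrightarrow> v \<in> verts E \<and> out_arcs E v = {}"

definition regular_vertex :: "('v, 'e) pre_digraph \<Rightarrow> 'v \<Rightarrow> bool" where
  "regular_vertex E v \<longleftrightarrow> v \<in> verts E \<and> out_arcs E v \<noteq> {} \<and> finite (out_arcs E v)"

definition path_from_to :: "('v, 'e) pre_digraph \<Rightarrow> 'v \<Rightarrow> 'v \<Rightarrow> bool" where
  "path_from_to E w v \<longleftrightarrow> (\<exists>p. pre_digraph.awalk E w p v)"

definition cycle_verts :: "('v, 'e) pre_digraph \<Rightarrow> 'e list \<Rightarrow> 'v set" where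
  "cycle_verts E c = tail E ` set c"

definition cycle_to_vertex :: "('v, 'e) pre_digraph \<Rightarrow> 'e list \<Rightarrow> 'v \<Rightarrow> bool" where
  "cycle_to_vertex E c v \<longleftrightarrow> (\<exists>u \<in> cycle_verts E c. path_from_to E u v)"

definition cycle_to_cycle :: "('v, 'e) pre_digraph \<Rightarrow> 'e list \<Rightarrow> 'e list \<Rightarrow> bool" where
  "cycle_to_cycle E d c \<longleftrightarrow>
     (\<exists>u \<in> cycle_verts E d. \<exists>w \<in> cycle_verts E c. path_from_to E u w)"

definition maximal_sink :: "('v, 'e) pre_digraph \<Rightarrow> 'v \<Rightarrow> bool" where
  "maximal_sink E v \<longleftrightarrow>
     sink E v \<and> \<not> (\<exists>c. pre_digraph.cycle E c \<and> cycle_to_vertex E c v)"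

definition maximal_cycle :: "('v, 'e) pre_digraph \<Rightarrow> 'e list \<Rightarrow> bool" where
  "maximal_cycle E c \<longleftrightarrow>
     pre_digraph.cycle E c \<and>
     \<not> (\<exists>d. pre_digraph.cycle E d \<and> (\<forall>n. d \<noteq> rotate n c) \<and> cycle_to_cycle E d c)"

definition predecessors :: "('v, 'e) pre_digraph \<Rightarrow> 'v \<Rightarrow> 'v set" where
  "predecessors E v = {w \<in> verts E. path_from_to E w v}"

text \<open>All vertices of a cycle have the same predecessors, so the union is that common set.\<close>

definition cycle_predecessors :: "('v, 'e) pre_digraph \<Rightarrow> 'e list \<Rightarrow> 'v set" where
  "cycle_predecessors E c = (\<Union>u \<in> cycle_verts E c. predecessors E u)"


section \<open>Free associative algebras\<close>

text \<open>
  Words form the free monoid, written additively because the product of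
  \<^theory>\<open>HOL-Library.Poly_Mapping\<close> is convolution over an additive monoid. Hence
  \<open>'x word \<Rightarrow>\<^sub>0 'k\<close> is the free unital associative \<open>'k\<close>-algebra on \<open>'x\<close>.
\<close>

datatype 'x word = Word (letters: "'x list")

instantiation word :: (type) monoid_add
begin

definition zero_word :: "'x word" where
  "zero_word = Word []"

definition plus_word :: "'x word \<Rightarrow> 'x word \<Rightarrow> 'x word" where
  "plus_word u w = Word (letters u @ letters w)"

instance
  by standard (simp_all add: zero_word_def plus_word_def)

end

type_synonym ('x, 'k) ncpoly = "'x word \<Rightarrow>\<^sub>0 'k"

definition ncvar :: "'x \<Rightarrow> ('x, 'k::field) ncpoly" where
  "ncvar x = Poly_Mapping.single (Word [x]) 1"

definition free_algebra :: "'x set \<Rightarrow> ('x, 'k::field) ncpoly ring" where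
  "free_algebra X =
     \<lparr>carrier = {a. \<forall>w \<in> Poly_Mapping.keys a. set (letters w) \<subseteq> X},
      mult = (*), one = 1, zero = 0, add = (+)\<rparr>"

text \<open>
  The non-unital free algebra: no constant term. The field \<^const>\<open>one\<close> of the record is
  left over from the unital algebra and is not an element of the carrier.
\<close>

definition free_nonunital_algebra :: "'x set \<Rightarrow> ('x, 'k::field) ncpoly ring" where
  "free_nonunital_algebra X =
     (free_algebra X)\<lparr>carrier :=
        {a \<in> carrier (free_algebra X). \<forall>w \<in> Poly_Mapping.keys a. letters w \<noteq> []}\<rparr>"

lemma ring_free_algebra: "ring (free_algebra X :: ('x, 'k::field) ncpoly ring)"
proof -
  let ?C = "carrier (free_algebra X) :: ('x, 'k) ncpoly set"
  have mem: "x \<in> ?C \<longleftrightarrow> (\<forall>w \<in> Poly_Mapping.keys x. set (letters w) \<subseteq> X)" for x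
    by (simp add: free_algebra_def)
  have zero: "0 \<in> ?C"
    by (simp add: mem)
  have one: "1 \<in> ?C"
    by (simp add: mem zero_word_def)
  have uminus: "- x \<in> ?C" if "x \<in> ?C" for x
    using that by (simp add: mem)
  have add: "x + y \<in> ?C" if "x \<in> ?C" "y \<in> ?C" for x y
    using that Poly_Mapping.keys_add[of x y] unfolding mem by blast
  have mult: "x * y \<in> ?C" if "x \<in> ?C" "y \<in> ?C" for x y
    unfolding mem
  proof
    fix w assume "w \<in> Poly_Mapping.keys (x * y)"
    then obtain u v where "w = u + v" "u \<in> Poly_Mapping.keys x" "v \<in> Poly_Mapping.keys y"
      using keys_mult[of x y] by blast
    then show "set (letters w) \<subseteq> X"
      using that unfolding mem by (auto simp: plus_word_def)
  qed
  have ops: "add (free_algebra X) = ((+) :: ('x, 'k) ncpoly \<Rightarrow> _)"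
    "mult (free_algebra X) = ((*) :: ('x, 'k) ncpoly \<Rightarrow> _)"
    "ring.zero (free_algebra X) = (0 :: ('x, 'k) ncpoly)"
    "one (free_algebra X) = (1 :: ('x, 'k) ncpoly)"
    by (simp_all add: free_algebra_def)
  show ?thesis
  proof (intro ringI abelian_groupI monoidI, unfold ops)
    show "\<exists>y \<in> ?C. y + x = 0" if "x \<in> ?C" for x
      using uminus[OF that] by (intro bexI[of _ "- x"]) simp_all
  qed (simp_all add: zero one add mult add.assoc mult.assoc add.commute distrib_left distrib_right)
qed


section \<open>Leavitt path algebras\<close>

datatype ('v, 'e) generator = Vert 'v | Edge 'e | Ghost 'e

definition generators :: "('v, 'e) pre_digraph \<Rightarrow> ('v, 'e) generator set" where
  "generators E = Vert ` verts E \<union> Edge ` arcs E \<union> Ghost ` arcs E"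

inductive_set leavitt_relators :: "('v, 'e) pre_digraph \<Rightarrow> (('v, 'e) generator, 'k::field) ncpoly set"
  for E :: "('v, 'e) pre_digraph"
where
  vertices: "v \<in> verts E \<Longrightarrow> w \<in> verts E \<Longrightarrow>
    ncvar (Vert v) * ncvar (Vert w) - (if v = w then ncvar (Vert w) else 0) \<in> leavitt_relators E"
| edge_source: "e \<in> arcs E \<Longrightarrow>
    ncvar (Vert (tail E e)) * ncvar (Edge e) - ncvar (Edge e) \<in> leavitt_relators E"
| edge_range: "e \<in> arcs E \<Longrightarrow>
    ncvar (Edge e) * ncvar (Vert (head E e)) - ncvar (Edge e) \<in> leavitt_relators E"
| ghost_range: "e \<in> arcs E \<Longrightarrow>
    ncvar (Vert (head E e)) * ncvar (Ghost e) - ncvar (Ghost e) \<in> leavitt_relators E"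
| ghost_source: "e \<in> arcs E \<Longrightarrow>
    ncvar (Ghost e) * ncvar (Vert (tail E e)) - ncvar (Ghost e) \<in> leavitt_relators E"
| CK1: "e \<in> arcs E \<Longrightarrow> f \<in> arcs E \<Longrightarrow>
    ncvar (Ghost e) * ncvar (Edge f) - (if e = f then ncvar (Vert (head E e)) else 0)
      \<in> leavitt_relators E"
| CK2: "regular_vertex E v \<Longrightarrow>
    ncvar (Vert v) - (\<Sum>e \<in> out_arcs E v. ncvar (Edge e) * ncvar (Ghost e)) \<in> leavitt_relators E"

text \<open>
  The ideal is generated inside the unital free algebra so that it is closed under scalars.
  No relator has a constant term, so the ideal is contained in the non-unital free algebra.
\<close>

definition leavitt_ideal :: "('v, 'e) pre_digraph \<Rightarrow> (('v, 'e) generator, 'k::field) ncpoly set" where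
  "leavitt_ideal E = genideal (free_algebra (generators E)) (leavitt_relators E)"

type_synonym ('v, 'e, 'k) leavitt_elem = "(('v, 'e) generator, 'k) ncpoly set"

text \<open>
  \<open>L\<^sub>K(E)\<close> for the field \<open>K = 'k\<close>. Its elements are cosets of \<^const>\<open>leavitt_ideal\<close>. The algebra need
  not have a unit; the field \<^const>\<open>one\<close> of the record is not meaningful.
\<close>

definition leavitt_path_algebra ::
  "('v, 'e) pre_digraph \<Rightarrow> ('k::field, ('v, 'e, 'k) leavitt_elem) module" where
  "leavitt_path_algebra E =
     (let F = free_nonunital_algebra (generators E); I = leavitt_ideal E
      in ring.extend (F Quot I)
           (module.fields
             (\<lambda>k A. \<Union>a \<in> A. a_r_coset F I (Poly_Mapping.single 0 k * a))))"

fun generator_degree :: "('v, 'e) generator \<Rightarrow> int" where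
  "generator_degree (Vert v) = 0"
| "generator_degree (Edge e) = 1"
| "generator_degree (Ghost e) = - 1"

definition word_degree :: "('v, 'e) generator word \<Rightarrow> int" where
  "word_degree w = sum_list (map generator_degree (letters w))"

definition leavitt_component ::
  "('v, 'e) pre_digraph \<Rightarrow> int \<Rightarrow> ('v, 'e, 'k::field) leavitt_elem set" where
  "leavitt_component E n =
     (let F = free_nonunital_algebra (generators E); I = leavitt_ideal E
      in a_r_coset F I `
           {a \<in> carrier F. \<forall>w \<in> Poly_Mapping.keys a. word_degree w = n})"


section \<open>Graded right modules and graded invariant basis number\<close>

text \<open>
  A grading of a ring or module is the family of its homogeneous components.
  Here \<open>'r\<close> is the ring of scalars, \<open>'m\<close> the type of module elements, \<open>'g\<close> the grading group.
\<close>

record ('r, 'm, 'g) graded_right_module = "'m partial_object" +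
  madd :: "'m \<Rightarrow> 'm \<Rightarrow> 'm"
  ract :: "'m \<Rightarrow> 'r \<Rightarrow> 'm"
  component :: "'g \<Rightarrow> 'm set"

definition shifted_regular_module ::
  "('a, 'b) ring_scheme \<Rightarrow> ('g::ab_group_add \<Rightarrow> 'a set) \<Rightarrow> 'g \<Rightarrow> ('a, 'a, 'g) graded_right_module"
where
  "shifted_regular_module R G \<delta> =
     \<lparr>carrier = carrier R, madd = add R, ract = mult R, component = (\<lambda>\<gamma>. G (\<delta> + \<gamma>))\<rparr>"

definition finite_direct_sum ::
  "nat \<Rightarrow> (nat \<Rightarrow> ('r, 'm, 'g) graded_right_module) \<Rightarrow> ('r, nat \<Rightarrow> 'm, 'g) graded_right_module"
where
  "finite_direct_sum n M =
     \<lparr>carrier = (\<Pi>\<^sub>E i \<in> {..<n}. carrier (M i)),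
      madd = (\<lambda>x y. \<lambda>i \<in> {..<n}. madd (M i) (x i) (y i)),
      ract = (\<lambda>x r. \<lambda>i \<in> {..<n}. ract (M i) (x i) r),
      component = (\<lambda>\<gamma>. \<Pi>\<^sub>E i \<in> {..<n}. component (M i) \<gamma>)\<rparr>"

definition graded_iso ::
  "('a, 'b) ring_scheme \<Rightarrow> ('a, 'm, 'g) graded_right_module \<Rightarrow> ('a, 'n, 'g) graded_right_module
    \<Rightarrow> ('m \<Rightarrow> 'n) set"
where
  "graded_iso R M N =
     {h. bij_betw h (carrier M) (carrier N) \<and>
         (\<forall>x \<in> carrier M. \<forall>y \<in> carrier M. h (madd M x y) = madd N (h x) (h y)) \<and>
         (\<forall>x \<in> carrier M. \<forall>r \<in> carrier R. h (ract M x r) = ract N (h x) r) \<and>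
         (\<forall>\<gamma>. h ` component M \<gamma> \<subseteq> component N \<gamma>)}"

definition gr_IBN :: "('a, 'b) ring_scheme \<Rightarrow> ('g::ab_group_add \<Rightarrow> 'a set) \<Rightarrow> bool" where
  "gr_IBN R G \<longleftrightarrow>
     (\<forall>m n :: nat. \<forall>\<alpha> \<beta> :: nat \<Rightarrow> 'g. m > 0 \<longrightarrow> n > 0 \<longrightarrow>
        graded_iso R (finite_direct_sum m (\<lambda>i. shifted_regular_module R G (\<alpha> i)))
                     (finite_direct_sum n (\<lambda>j. shifted_regular_module R G (\<beta> j))) \<noteq> {} \<longrightarrow>
        m = n)"

end

theory Submission
  imports Defs
begin

text \<open>
  A ring with a nonzero finite-dimensional representation whose image contains the identity has
  invariant basis number, because two mutually inverse rectangular matrices over the ring would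
  become mutually inverse rectangular matrices over the field. So it is enough to represent
  \<open>L\<^sub>K(E)\<close> on a finite-dimensional space.

  The representation is Chen's module of boundary paths. A vertex acts as the projection onto
  the paths that start there, an edge \<open>e\<close> prolongs a path to \<open>e p\<close>, and \<open>e\<^sup>*\<close> removes an initial
  \<open>e\<close>. Only paths that stay among the predecessors of the given sink or cycle are used: for a
  sink \<open>v\<close> the finite paths ending in \<open>v\<close>, for a cycle \<open>c\<close> the infinite paths inside the
  predecessors of \<open>c\<close>, all of which finally run around \<open>c\<close>. The hypotheses make both sets finite.
  If the sink is maximal, then a path to it never repeats a vertex, since a repetition would be a
  cycle above the sink. If the cycle is maximal, then a path inside its predecessors can repeat
  a vertex only on \<open>c\<close>, and it cannot leave \<open>c\<close> again, so a bounded initial segment determines it.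

  \<open>L\<^sub>K(E)\<close> may lack a unit, so a module map \<open>R\<^sup>m \<rightarrow> R\<^sup>n\<close> need not be given by a matrix over \<open>R\<close>.
  Local units replace the unit: see \<open>rep_hom_component\<close>. The passage from
  representations to invariant basis number is \<open>gr_IBN_of_representation\<close>; the verification of the
  defining relations is \<open>relator_matrix_eq_zero\<close>; the two sets of paths are treated in
  \<open>finite_branching_system_sink\<close> and \<open>finite_branching_system_cycle\<close>.
\<close>

section \<open>Linear algebra\<close>

text \<open>
  Induction on the equations: an equation without nonzero coefficients is dropped, any other one
  is solved for an unknown \<open>i0\<close>, which is then eliminated from the remaining equations.
\<close>

lemma homogeneous_system_nontrivial_solution:
  fixes A :: "'j \<Rightarrow> 'i \<Rightarrow> 'k::field"
  assumes "finite J" "finite I" "card J < card I"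
  shows "\<exists>c. (\<exists>i\<in>I. c i \<noteq> 0) \<and> (\<forall>j\<in>J. (\<Sum>i\<in>I. A j i * c i) = 0)"
  using assms
proof (induction J arbitrary: I A rule: finite_induct)
  case empty
  then obtain i where "i \<in> I"
    by fastforce
  then show ?case
    by (intro exI[of _ "\<lambda>_. 1"]) auto
next
  case (insert j J)
  show ?case
  proof (cases "\<forall>i\<in>I. A j i = 0")
    case True
    have "card J < card I"
      using insert by simp
    then obtain c where "\<exists>i\<in>I. c i \<noteq> 0" "\<forall>j\<in>J. (\<Sum>i\<in>I. A j i * c i) = 0"
      using insert.IH[OF insert.prems(1)] by blast
    then show ?thesis
      using True by (intro exI[of _ c]) simp
  next
    case False
    then obtain i0 where i0: "i0 \<in> I" "A j i0 \<noteq> 0"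
      by blast
    define I' where "I' = I - {i0}"
    define A' where "A' l i = A l i - A l i0 * A j i / A j i0" for l i
    have I': "finite I'" "i0 \<notin> I'" "I = insert i0 I'"
      using insert.prems i0 by (auto simp: I'_def)
    moreover have "card J < card I'"
      using insert I' by simp
    ultimately obtain c where c: "\<exists>i\<in>I'. c i \<noteq> 0" "\<forall>l\<in>J. (\<Sum>i\<in>I'. A' l i * c i) = 0"
      using insert.IH[of I' A'] by blast
    define t where "t = - (\<Sum>i\<in>I'. A j i * c i) / A j i0"
    define d where "d = c(i0 := t)"
    have sum_d: "(\<Sum>i\<in>I. A l i * d i) = A l i0 * t + (\<Sum>i\<in>I'. A l i * c i)" for l
    proof -
      have "(\<Sum>i\<in>I'. A l i * d i) = (\<Sum>i\<in>I'. A l i * c i)"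
        using I' by (intro sum.cong) (auto simp: d_def)
      then show ?thesis
        using I' by (simp add: d_def)
    qed
    have "(\<Sum>i\<in>I. A l i * d i) = 0" if "l \<in> J" for l
    proof -
      have "(\<Sum>i\<in>I'. A' l i * c i)
            = (\<Sum>i\<in>I'. A l i * c i) - A l i0 / A j i0 * (\<Sum>i\<in>I'. A j i * c i)"
        by (simp add: A'_def left_diff_distrib sum_subtractf sum_distrib_left mult.assoc)
      also have "\<dots> = (\<Sum>i\<in>I. A l i * d i)"
        by (simp add: sum_d t_def)
      finally show ?thesis
        using c that by simp
    qed
    moreover have "(\<Sum>i\<in>I. A j i * d i) = 0"
      using i0 by (simp add: sum_d t_def)
    moreover have "\<exists>i\<in>I. d i \<noteq> 0"
      using c I' by (auto simp: d_def)
    ultimately show ?thesis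
      by (intro exI[of _ d]) auto
  qed
qed

text \<open>
  With fewer rows than columns \<open>A\<close> would kill a nonzero vector, but \<open>B A = 1\<close> makes \<open>A\<close> injective.
\<close>

lemma left_invertible_matrix_card_le:
  fixes A :: "'j \<Rightarrow> 'i \<Rightarrow> 'k::field" and B :: "'i \<Rightarrow> 'j \<Rightarrow> 'k"
  assumes "finite I" "finite J"
    and inv: "\<And>i i'. i \<in> I \<Longrightarrow> i' \<in> I \<Longrightarrow> (\<Sum>j\<in>J. B i j * A j i') = of_bool (i = i')"
  shows "card I \<le> card J"
proof (rule ccontr)
  assume "\<not> card I \<le> card J"
  then obtain c where c: "\<exists>i\<in>I. c i \<noteq> 0" "\<forall>j\<in>J. (\<Sum>i\<in>I. A j i * c i) = 0"
    using homogeneous_system_nontrivial_solution[OF assms(2,1), of A] by auto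
  have "c i = 0" if "i \<in> I" for i
  proof -
    have "c i = (\<Sum>i'\<in>I. of_bool (i = i') * c i')"
      using assms that by (simp add: of_bool_def if_distrib[of "\<lambda>x. x * _"] sum.delta cong: if_cong)
    also have "\<dots> = (\<Sum>i'\<in>I. \<Sum>j\<in>J. B i j * (A j i' * c i'))"
      using that by (intro sum.cong refl) (simp add: inv[symmetric] sum_distrib_right mult.assoc)
    also have "\<dots> = (\<Sum>j\<in>J. B i j * (\<Sum>i'\<in>I. A j i' * c i'))"
      by (subst sum.swap) (simp add: sum_distrib_left)
    also have "\<dots> = 0"
      using c by simp
    finally show ?thesis .
  qed
  then show False
    using c by blast
qed


section \<open>Rings with a finite-dimensional representation\<close>

definition module_hom ::
  "('a, 'b) ring_scheme \<Rightarrow> ('a, 'm, 'g) graded_right_module \<Rightarrow> ('a, 'n, 'g) graded_right_module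
    \<Rightarrow> ('m \<Rightarrow> 'n) set"
where
  "module_hom R M N =
     {h \<in> carrier M \<rightarrow> carrier N.
        (\<forall>x \<in> carrier M. \<forall>y \<in> carrier M. h (madd M x y) = madd N (h x) (h y)) \<and>
        (\<forall>x \<in> carrier M. \<forall>r \<in> carrier R. h (ract M x r) = ract N (h x) r)}"

text \<open>
  A matrix representation over a field, with rows and columns indexed by \<open>X\<close>, of a ring with
  left local units. The element represented by the identity matrix makes the representation
  unital although \<open>R\<close> need not be.
\<close>

locale locally_unital_representation =
  fixes R :: "('a, 'b) ring_scheme" (structure)
    and X :: "'x set"
    and \<rho> :: "'a \<Rightarrow> 'x \<Rightarrow> 'x \<Rightarrow> 'k::field"
  assumes abelian: "abelian_monoid R"
    and mult_closed: "a \<in> carrier R \<Longrightarrow> b \<in> carrier R \<Longrightarrow> a \<otimes> b \<in> carrier R"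
    and zero_mult: "a \<in> carrier R \<Longrightarrow> \<zero> \<otimes> a = \<zero>"
    and left_local_unit:
      "finite S \<Longrightarrow> S \<subseteq> carrier R \<Longrightarrow> \<exists>f \<in> carrier R. \<forall>s \<in> S. f \<otimes> s = s"
    and finite_X: "finite X" and X_nonempty: "X \<noteq> {}"
    and rep_add: "a \<in> carrier R \<Longrightarrow> b \<in> carrier R \<Longrightarrow> p \<in> X \<Longrightarrow> q \<in> X \<Longrightarrow>
      \<rho> (a \<oplus> b) p q = \<rho> a p q + \<rho> b p q"
    and rep_mult: "a \<in> carrier R \<Longrightarrow> b \<in> carrier R \<Longrightarrow> p \<in> X \<Longrightarrow> q \<in> X \<Longrightarrow>
      \<rho> (a \<otimes> b) p q = (\<Sum>r\<in>X. \<rho> a p r * \<rho> b r q)"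
    and rep_identity:
      "\<exists>e \<in> carrier R. \<forall>p \<in> X. \<forall>q \<in> X. \<rho> e p q = of_bool (p = q)"
begin

sublocale abelian_monoid R
  by (rule abelian)

definition free_module ::
  "('g::ab_group_add \<Rightarrow> 'a set) \<Rightarrow> nat \<Rightarrow> (nat \<Rightarrow> 'g) \<Rightarrow> ('a, nat \<Rightarrow> 'a, 'g) graded_right_module"
  where "free_module G n \<alpha> = finite_direct_sum n (\<lambda>i. shifted_regular_module R G (\<alpha> i))"

lemma free_module_simps:
  "carrier (free_module G n \<alpha>) = (\<Pi>\<^sub>E i\<in>{..<n}. carrier R)"
  "madd (free_module G n \<alpha>) x y = (\<lambda>i\<in>{..<n}. x i \<oplus> y i)"
  "ract (free_module G n \<alpha>) x r = (\<lambda>i\<in>{..<n}. x i \<otimes> r)"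
  by (simp_all add: free_module_def finite_direct_sum_def shifted_regular_module_def)

definition unit_tuple :: "nat \<Rightarrow> nat \<Rightarrow> 'a \<Rightarrow> nat \<Rightarrow> 'a"
  where "unit_tuple n j a = (\<lambda>i\<in>{..<n}. if i = j then a else \<zero>)"

lemma unit_tuple_closed:
  "a \<in> carrier R \<Longrightarrow> unit_tuple n j a \<in> carrier (free_module G n \<alpha>)"
  by (auto simp: unit_tuple_def free_module_simps)

lemma rep_zero: "p \<in> X \<Longrightarrow> q \<in> X \<Longrightarrow> \<rho> \<zero> p q = 0"
  using rep_add[of "\<zero>" "\<zero>" p q] by (metis add_cancel_right_left l_zero zero_closed)

text \<open>
  If \<open>R\<close> had a unit, \<open>g\<close> would be left multiplication by the matrix with entries \<open>g(\<epsilon>\<^sub>j)\<^sub>i\<close>. Here a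
  left unit \<open>f\<close> for the finitely many entries of \<open>x\<close> takes over its role for this one \<open>x\<close>:
  \<open>x\<close> is the sum of the tuples \<open>f \<epsilon>\<^sub>j\<close> multiplied by \<open>x\<^sub>j\<close>, and \<open>g\<close> is additive and linear. The
  coordinates are added one at a time, whence the truncations of \<open>x\<close>.
\<close>

lemma rep_hom_component:
  assumes g: "g \<in> module_hom R (free_module G n \<alpha>) (free_module H m \<beta>)"
    and x: "x \<in> carrier (free_module G n \<alpha>)"
    and f: "f \<in> carrier R" "\<And>j. j < n \<Longrightarrow> f \<otimes> x j = x j"
    and "i < m" "p \<in> X" "q \<in> X"
  shows "\<rho> (g x i) p q = (\<Sum>j<n. \<Sum>r\<in>X. \<rho> (g (unit_tuple n j f) i) p r * \<rho> (x j) r q)"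
proof -
  let ?M = "free_module G n \<alpha>" and ?N = "free_module H m \<beta>"
  define trunc where "trunc k = (\<lambda>l\<in>{..<n}. if l < k then x l else \<zero>)" for k
  have xj: "x j \<in> carrier R" if "j < n" for j
    using x that by (auto simp: free_module_simps)
  have trunc: "trunc k \<in> carrier ?M" for k
    using xj by (auto simp: trunc_def free_module_simps)
  have g_closed: "g y i \<in> carrier R" if "y \<in> carrier ?M" for y
    using g that \<open>i < m\<close> by (auto simp: module_hom_def free_module_simps Pi_iff PiE_iff)
  have g_add: "\<rho> (g (madd ?M y z) i) p q = \<rho> (g y i) p q + \<rho> (g z i) p q"
    if "y \<in> carrier ?M" "z \<in> carrier ?M" for y z
  proof -
    have "g (madd ?M y z) i = g y i \<oplus> g z i"
      using g that \<open>i < m\<close> by (simp add: module_hom_def free_module_simps)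
    then show ?thesis
      using g_closed that assms by (simp add: rep_add)
  qed
  have main: "\<rho> (g (trunc k) i) p q = (\<Sum>j<k. \<Sum>r\<in>X. \<rho> (g (unit_tuple n j f) i) p r * \<rho> (x j) r q)"
    if "k \<le> n" for k
    using that
  proof (induction k)
    case 0
    have "madd ?M (trunc 0) (trunc 0) = trunc 0"
      by (auto simp: free_module_simps trunc_def)
    then have "\<rho> (g (trunc 0) i) p q = 0"
      using g_add[OF trunc trunc, of 0 0] by (simp only: add_cancel_right_left)
    then show ?case
      by simp
  next
    case (Suc k)
    have xk: "x k \<in> carrier R" "f \<otimes> x k = x k"
      using Suc.prems xj f by simp_all
    have ut: "ract ?M (unit_tuple n k f) (x k) \<in> carrier ?M"
      using f(1) xk zero_mult by (auto simp: free_module_simps unit_tuple_def)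
    have "trunc (Suc k) = madd ?M (trunc k) (ract ?M (unit_tuple n k f) (x k))"
      using xj xk zero_mult by (auto simp: free_module_simps trunc_def unit_tuple_def fun_eq_iff less_Suc_eq)
    moreover have "g (ract ?M (unit_tuple n k f) (x k)) i = g (unit_tuple n k f) i \<otimes> x k"
      using g xk unit_tuple_closed[OF f(1), where G = G and \<alpha> = \<alpha>] \<open>i < m\<close>
      by (simp add: module_hom_def free_module_simps)
    ultimately have "\<rho> (g (trunc (Suc k)) i) p q
        = \<rho> (g (trunc k) i) p q + (\<Sum>r\<in>X. \<rho> (g (unit_tuple n k f) i) p r * \<rho> (x k) r q)"
      using g_add[OF trunc ut] rep_mult[OF g_closed[OF unit_tuple_closed[OF f(1)]] xk(1)]
        assms(6,7) by simp
    then show ?case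
      using Suc by simp
  qed
  have "trunc n = x"
    using x by (auto simp: trunc_def free_module_simps fun_eq_iff PiE_def extensional_def)
  with main[OF order.refl] show ?thesis
    by simp
qed

text \<open>
  Let \<open>e\<close> be represented by the identity matrix. The images \<open>h(e \<epsilon>\<^sub>i)\<close> give a matrix \<open>A\<close>, and
  for a common left unit \<open>f\<close> of all their entries the images \<open>g(f \<epsilon>\<^sub>j)\<close> give a matrix \<open>B\<close>. Since
  \<open>g(h(e \<epsilon>\<^sub>i)) = e \<epsilon>\<^sub>i\<close>, the block matrices of \<open>A\<close> and \<open>B\<close> under \<open>\<rho>\<close> satisfy \<open>B A = 1\<close>, and
  their sizes are \<open>m |X|\<close> and \<open>n |X|\<close>.
\<close>

lemma free_module_rank_le:
  assumes h: "h \<in> module_hom R (free_module G m \<alpha>) (free_module H n \<beta>)"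
    and g: "g \<in> module_hom R (free_module H n \<beta>) (free_module G m \<alpha>)"
    and gh: "\<And>x. x \<in> carrier (free_module G m \<alpha>) \<Longrightarrow> g (h x) = x"
  shows "m \<le> n"
proof -
  let ?M = "free_module G m \<alpha>" and ?N = "free_module H n \<beta>"
  obtain e where e: "e \<in> carrier R" "\<And>p q. p \<in> X \<Longrightarrow> q \<in> X \<Longrightarrow> \<rho> e p q = of_bool (p = q)"
    using rep_identity by blast
  define y where "y i = h (unit_tuple m i e)" for i
  have y: "y i \<in> carrier ?N" for i
    using h unit_tuple_closed[OF e(1), where G = G and \<alpha> = \<alpha>] by (auto simp: module_hom_def y_def)
  let ?S = "(\<lambda>(i, j). y i j) ` ({..<m} \<times> {..<n})"
  have "?S \<subseteq> carrier R"
    using y by (auto simp: free_module_simps PiE_iff)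
  then obtain f where f: "f \<in> carrier R" "\<forall>s\<in>?S. f \<otimes> s = s"
    using left_local_unit[of ?S] by auto
  define A where "A = (\<lambda>(j, r) (i, q). \<rho> (y i j) r q)"
  define B where "B = (\<lambda>(i, p) (j, r). \<rho> (g (unit_tuple n j f) i) p r)"
  have BA: "(\<Sum>w\<in>{..<n} \<times> X. B u w * A w v) = of_bool (u = v)"
    if uv: "u \<in> {..<m} \<times> X" "v \<in> {..<m} \<times> X" for u v
  proof -
    obtain i p i' q where [simp]: "u = (i, p)" "v = (i', q)"
      by fastforce
    have mem: "i < m" "i' < m" "p \<in> X" "q \<in> X"
      using uv by auto
    have "(\<Sum>w\<in>{..<n} \<times> X. B u w * A w v)
        = (\<Sum>j<n. \<Sum>r\<in>X. \<rho> (g (unit_tuple n j f) i) p r * \<rho> (y i' j) r q)"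
      by (simp add: A_def B_def sum.cartesian_product split_beta)
    also have "\<dots> = \<rho> (g (y i') i) p q"
      using f mem by (intro rep_hom_component[OF g y, symmetric]) auto
    also have "g (y i') = unit_tuple m i' e"
      using gh unit_tuple_closed[OF e(1), where G = G and \<alpha> = \<alpha>] by (simp add: y_def)
    also have "\<rho> (unit_tuple m i' e i) p q = of_bool (u = v)"
      using mem e(2) rep_zero by (auto simp: unit_tuple_def)
    finally show ?thesis .
  qed
  have "card ({..<m} \<times> X) \<le> card ({..<n} \<times> X)"
    using finite_X by (intro left_invertible_matrix_card_le[OF _ _ BA]) auto
  then show ?thesis
    using finite_X X_nonempty by (simp add: card_cartesian_product card_gt_0_iff)
qed

lemma graded_iso_imp_module_hom:
  assumes "h \<in> graded_iso R M N"
    and closed: "\<And>x y. x \<in> carrier M \<Longrightarrow> y \<in> carrier M \<Longrightarrow> madd M x y \<in> carrier M"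
      "\<And>x r. x \<in> carrier M \<Longrightarrow> r \<in> carrier R \<Longrightarrow> ract M x r \<in> carrier M"
  shows "h \<in> module_hom R M N" "inv_into (carrier M) h \<in> module_hom R N M"
proof -
  let ?g = "inv_into (carrier M) h"
  have bij: "bij_betw h (carrier M) (carrier N)"
    and add: "\<And>x y. x \<in> carrier M \<Longrightarrow> y \<in> carrier M \<Longrightarrow> h (madd M x y) = madd N (h x) (h y)"
    and act: "\<And>x r. x \<in> carrier M \<Longrightarrow> r \<in> carrier R \<Longrightarrow> h (ract M x r) = ract N (h x) r"
    using assms(1) by (auto simp: graded_iso_def)
  show "h \<in> module_hom R M N"
    using bij add act by (auto simp: module_hom_def bij_betw_def)
  have g: "?g y \<in> carrier M" "h (?g y) = y" if "y \<in> carrier N" for y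
    using bij that by (auto simp: bij_betw_def inv_into_into f_inv_into_f)
  have g_h: "?g (h x) = x" if "x \<in> carrier M" for x
    using bij that by (simp add: bij_betw_def)
  have "?g (madd N y z) = madd M (?g y) (?g z)" if "y \<in> carrier N" "z \<in> carrier N" for y z
    using g_h[of "madd M (?g y) (?g z)"] add g closed that by simp
  moreover have "?g (ract N y r) = ract M (?g y) r" if "y \<in> carrier N" "r \<in> carrier R" for y r
    using g_h[of "ract M (?g y) r"] act g closed that by simp
  ultimately show "?g \<in> module_hom R N M"
    using g by (auto simp: module_hom_def)
qed

theorem gr_IBN_of_representation: "gr_IBN R (G :: 'g::ab_group_add \<Rightarrow> 'a set)"
  unfolding gr_IBN_def
proof (intro allI impI)
  fix m n :: nat and \<alpha> \<beta> :: "nat \<Rightarrow> 'g"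
  let ?M = "free_module G m \<alpha>" and ?N = "free_module G n \<beta>"
  assume "graded_iso R (finite_direct_sum m (\<lambda>i. shifted_regular_module R G (\<alpha> i)))
           (finite_direct_sum n (\<lambda>j. shifted_regular_module R G (\<beta> j))) \<noteq> {}"
  then obtain h where h: "h \<in> graded_iso R ?M ?N"
    by (auto simp: free_module_def)
  have closed: "madd ?M x y \<in> carrier ?M" if "x \<in> carrier ?M" "y \<in> carrier ?M" for x y
    using that by (auto simp: free_module_simps PiE_iff)
  have closed': "ract ?M x r \<in> carrier ?M" if "x \<in> carrier ?M" "r \<in> carrier R" for x r
    using that mult_closed by (auto simp: free_module_simps PiE_iff)
  let ?g = "inv_into (carrier ?M) h"
  have homs: "h \<in> module_hom R ?M ?N" "?g \<in> module_hom R ?N ?M"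
    using graded_iso_imp_module_hom[OF h closed closed'] by blast+
  have "bij_betw h (carrier ?M) (carrier ?N)"
    using h by (simp add: graded_iso_def)
  then have "?g (h x) = x" if "x \<in> carrier ?M" for x
    using that by (simp add: bij_betw_def)
  moreover have "h (?g y) = y" if "y \<in> carrier ?N" for y
    using that \<open>bij_betw h _ _\<close> by (simp add: bij_betw_def f_inv_into_f)
  ultimately show "m = n"
    using free_module_rank_le[OF homs] free_module_rank_le[OF homs(2,1)] by (simp add: order.antisym)
qed

end


section \<open>Matrix representations of free algebras\<close>

text \<open>
  An assignment \<open>M\<close> of \<open>X \<times> X\<close> matrices to the generators extends to the free algebra. The matrices
  are functions on the whole type, of which only the entries in \<open>X\<close> have a meaning.
\<close>

primrec word_matrix :: "'x set \<Rightarrow> ('g \<Rightarrow> 'x \<Rightarrow> 'x \<Rightarrow> 'k::field) \<Rightarrow> 'g list \<Rightarrow> 'x \<Rightarrow> 'x \<Rightarrow> 'k" where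
  "word_matrix X M [] = (\<lambda>p q. of_bool (p = q))"
| "word_matrix X M (x # w) = (\<lambda>p q. \<Sum>r\<in>X. M x p r * word_matrix X M w r q)"

definition poly_matrix ::
  "'x set \<Rightarrow> ('g \<Rightarrow> 'x \<Rightarrow> 'x \<Rightarrow> 'k::field) \<Rightarrow> ('g, 'k) ncpoly \<Rightarrow> 'x \<Rightarrow> 'x \<Rightarrow> 'k"
where
  "poly_matrix X M a = (\<lambda>p q. \<Sum>w\<in>Poly_Mapping.keys a.
     Poly_Mapping.lookup a w * word_matrix X M (letters w) p q)"

lemma sum_of_bool_eq_mult:
  fixes f :: "'x \<Rightarrow> 'k::field"
  assumes "finite X" "p \<in> X"
  shows "(\<Sum>r\<in>X. of_bool (p = r) * f r) = f p" "(\<Sum>r\<in>X. f r * of_bool (r = p)) = f p"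
  using assms by (simp_all add: of_bool_def if_distrib[of "\<lambda>x. x * _"] if_distrib[of "\<lambda>x. _ * x"] cong: if_cong)

lemma word_matrix_append:
  assumes "finite X" "p \<in> X"
  shows "word_matrix X M (u @ w) p q = (\<Sum>r\<in>X. word_matrix X M u p r * word_matrix X M w r q)"
  using assms(2)
proof (induction u arbitrary: p)
  case Nil
  then show ?case
    using assms(1) by (simp add: sum_of_bool_eq_mult)
next
  case (Cons x u)
  have "word_matrix X M ((x # u) @ w) p q
      = (\<Sum>s\<in>X. \<Sum>r\<in>X. M x p s * (word_matrix X M u s r * word_matrix X M w r q))"
    using Cons.IH by (simp add: sum_distrib_left)
  also have "\<dots> = (\<Sum>r\<in>X. word_matrix X M (x # u) p r * word_matrix X M w r q)"
    by (subst sum.swap) (simp add: sum_distrib_right mult.assoc)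
  finally show ?case .
qed

lemma poly_matrix_add:
  "poly_matrix X M (a + b) p q = poly_matrix X M a p q + poly_matrix X M b p q"
proof -
  let ?K = "Poly_Mapping.keys a \<union> Poly_Mapping.keys b"
  have superset: "poly_matrix X M c p q
      = (\<Sum>w\<in>?K. Poly_Mapping.lookup c w * word_matrix X M (letters w) p q)"
    if "Poly_Mapping.keys c \<subseteq> ?K" for c
    unfolding poly_matrix_def using that
    by (intro sum.mono_neutral_left) (auto simp: in_keys_iff)
  show ?thesis
    using Poly_Mapping.keys_add[of a b]
    by (simp add: superset Poly_Mapping.lookup_add distrib_right sum.distrib)
qed

lemma poly_matrix_zero [simp]: "poly_matrix X M 0 p q = 0"
  by (simp add: poly_matrix_def)

lemma poly_matrix_uminus: "poly_matrix X M (- a) p q = - poly_matrix X M a p q"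
  using poly_matrix_add[of X M a "- a" p q] by (simp add: eq_neg_iff_add_eq_0 add.commute)

lemma poly_matrix_diff:
  "poly_matrix X M (a - b) p q = poly_matrix X M a p q - poly_matrix X M b p q"
  using poly_matrix_add[of X M a "- b" p q] by (simp add: poly_matrix_uminus)

lemma poly_matrix_sum:
  "poly_matrix X M (\<Sum>i\<in>I. a i) p q = (\<Sum>i\<in>I. poly_matrix X M (a i) p q)"
  by (induction I rule: infinite_finite_induct) (simp_all add: poly_matrix_add)

lemma poly_matrix_single:
  "poly_matrix X M (Poly_Mapping.single w c) p q = c * word_matrix X M (letters w) p q"
  by (cases "c = 0") (simp_all add: poly_matrix_def)

lemma ncpoly_eq_sum_single:
  "a = (\<Sum>w\<in>Poly_Mapping.keys a. Poly_Mapping.single w (Poly_Mapping.lookup a w))"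
  by (rule poly_mapping_eqI)
    (simp add: Poly_Mapping.lookup_sum Poly_Mapping.lookup_single when_def in_keys_iff)

lemma poly_matrix_mult:
  assumes "finite X" "p \<in> X"
  shows "poly_matrix X M (a * b) p q = (\<Sum>r\<in>X. poly_matrix X M a p r * poly_matrix X M b r q)"
proof -
  have single: "poly_matrix X M (Poly_Mapping.single u c * Poly_Mapping.single w d) p q
      = (\<Sum>r\<in>X. poly_matrix X M (Poly_Mapping.single u c) p r
                * poly_matrix X M (Poly_Mapping.single w d) r q)" for u w c d
    using assms
    by (simp add: mult_single poly_matrix_single plus_word_def word_matrix_append sum_distrib_left
        mult_ac)
  let ?s = "\<lambda>a w. Poly_Mapping.single w (Poly_Mapping.lookup a w)"
  have expand: "(\<Sum>w\<in>Poly_Mapping.keys c. poly_matrix X M (?s c w) p' q') = poly_matrix X M c p' q'"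
    for c p' q'
    unfolding poly_matrix_sum[symmetric] by (simp only: ncpoly_eq_sum_single[symmetric])
  have "a * b = (\<Sum>u\<in>Poly_Mapping.keys a. ?s a u) * (\<Sum>w\<in>Poly_Mapping.keys b. ?s b w)"
    by (rule arg_cong2[of _ _ _ _ "(*)"]; rule ncpoly_eq_sum_single)
  then have "poly_matrix X M (a * b) p q = (\<Sum>u\<in>Poly_Mapping.keys a. \<Sum>w\<in>Poly_Mapping.keys b. \<Sum>r\<in>X.
      poly_matrix X M (?s a u) p r * poly_matrix X M (?s b w) r q)"
    by (simp only: sum_product poly_matrix_sum single)
  also have "\<dots> = (\<Sum>u\<in>Poly_Mapping.keys a. \<Sum>r\<in>X. \<Sum>w\<in>Poly_Mapping.keys b.
      poly_matrix X M (?s a u) p r * poly_matrix X M (?s b w) r q)"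
    by (intro sum.cong refl sum.swap)
  also have "\<dots> = (\<Sum>r\<in>X. \<Sum>u\<in>Poly_Mapping.keys a. \<Sum>w\<in>Poly_Mapping.keys b.
      poly_matrix X M (?s a u) p r * poly_matrix X M (?s b w) r q)"
    by (rule sum.swap)
  also have "\<dots> = (\<Sum>r\<in>X. poly_matrix X M a p r * poly_matrix X M b r q)"
    by (simp only: sum_product[symmetric] expand)
  finally show ?thesis .
qed

lemma poly_matrix_ncvar:
  assumes "finite X" "q \<in> X"
  shows "poly_matrix X M (ncvar x) p q = M x p q"
  using assms by (simp add: ncvar_def poly_matrix_single sum_of_bool_eq_mult)


section \<open>The Leavitt path algebra as a ring of cosets\<close>

lemma carrier_free_algebra:
  "a \<in> carrier (free_algebra X) \<longleftrightarrow> (\<forall>w \<in> Poly_Mapping.keys a. set (letters w) \<subseteq> X)"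
  by (simp add: free_algebra_def)

lemma free_algebra_ops [simp]:
  "add (free_algebra X) = ((+) :: ('x, 'k::field) ncpoly \<Rightarrow> _)"
  "mult (free_algebra X) = ((*) :: ('x, 'k) ncpoly \<Rightarrow> _)"
  "ring.zero (free_algebra X) = (0 :: ('x, 'k) ncpoly)"
  "one (free_algebra X) = (1 :: ('x, 'k) ncpoly)"
  by (simp_all add: free_algebra_def)

lemma a_inv_free_algebra:
  assumes "(a :: ('x, 'k::field) ncpoly) \<in> carrier (free_algebra X)"
  shows "a_inv (free_algebra X) a = - a"
proof -
  interpret ring "free_algebra X :: ('x, 'k) ncpoly ring"
    by (rule ring_free_algebra)
  have "- a \<in> carrier (free_algebra X)"
    using assms by (simp add: carrier_free_algebra)
  then show ?thesis
    using assms minus_equality[of "- a" a] by simp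
qed

lemma ncvar_in_carrier: "x \<in> X \<Longrightarrow> ncvar x \<in> carrier (free_algebra X)"
  by (simp add: carrier_free_algebra ncvar_def)

lemma free_algebra_closed:
  fixes a b :: "('x, 'k::field) ncpoly"
  assumes "a \<in> carrier (free_algebra X)" "b \<in> carrier (free_algebra X)"
  shows "a + b \<in> carrier (free_algebra X)" "a - b \<in> carrier (free_algebra X)"
    "a * b \<in> carrier (free_algebra X)"
proof -
  interpret ring "free_algebra X :: ('x, 'k) ncpoly ring"
    by (rule ring_free_algebra)
  show "a + b \<in> carrier (free_algebra X)" "a * b \<in> carrier (free_algebra X)"
    using add.m_closed[OF assms] m_closed[OF assms] by simp_all
  show "a - b \<in> carrier (free_algebra X)"
    using minus_closed[OF assms] assms by (simp add: a_minus_def a_inv_free_algebra)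
qed

lemma free_algebra_sum_closed:
  "(\<And>i. i \<in> I \<Longrightarrow> a i \<in> carrier (free_algebra X)) \<Longrightarrow> (\<Sum>i\<in>I. a i) \<in> carrier (free_algebra X)"
  by (induction I rule: infinite_finite_induct)
    (auto intro: free_algebra_closed simp: carrier_free_algebra[of 0])

lemma leavitt_relators_subset:
  assumes "wf_digraph E"
  shows "leavitt_relators E \<subseteq> carrier (free_algebra (generators E) :: (_, 'k::field) ncpoly ring)"
proof
  interpret wf_digraph E by fact
  let ?C = "carrier (free_algebra (generators E)) :: (_, 'k) ncpoly set"
  have zero: "(0 :: (_, 'k) ncpoly) \<in> ?C"
    by (simp add: carrier_free_algebra)
  have gens: "v \<in> verts E \<Longrightarrow> ncvar (Vert v) \<in> ?C" "e \<in> arcs E \<Longrightarrow> ncvar (Edge e) \<in> ?C"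
    "e \<in> arcs E \<Longrightarrow> ncvar (Ghost e) \<in> ?C" for v e
    by (auto intro!: ncvar_in_carrier simp: generators_def)
  fix a :: "(_, 'k) ncpoly" assume "a \<in> leavitt_relators E"
  then show "a \<in> ?C"
    by cases (auto intro!: free_algebra_closed free_algebra_sum_closed gens zero
        simp: regular_vertex_def)
qed


text \<open>
  The non-unital free algebra \<open>F\<close> does not contain its formal unit, so it is not an instance of
  \<^locale>\<open>ring\<close> and the general facts on quotient rings do not apply to \<open>F Quot I\<close>. Sums and
  products of cosets are computed from the fact that \<open>I\<close> is an ideal of the unital algebra \<open>A\<close>.
\<close>

context wf_digraph
begin

abbreviation (input) A where "A \<equiv> free_algebra (generators G)"
abbreviation (input) F where "F \<equiv> free_nonunital_algebra (generators G)"
abbreviation (input) I where "I \<equiv> leavitt_ideal G"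
abbreviation (input) L where "L \<equiv> leavitt_path_algebra G"

definition leavitt_class :: "(('a, 'b) generator, 'k::field) ncpoly \<Rightarrow> ('a, 'b, 'k) leavitt_elem" where
  "leavitt_class a = a_r_coset F I a"

lemma ideal_leavitt_ideal: "ideal I A"
  unfolding leavitt_ideal_def
  by (intro ring.genideal_ideal ring_free_algebra leavitt_relators_subset wf_digraph_axioms)

lemma ideal_subset: "a \<in> I \<Longrightarrow> a \<in> carrier A"
  by (rule ideal.Icarr[OF ideal_leavitt_ideal])

lemma relator_in_ideal: "a \<in> leavitt_relators G \<Longrightarrow> a \<in> I"
  using ring.genideal_self[OF ring_free_algebra, OF leavitt_relators_subset[OF wf_digraph_axioms]] by (auto simp: leavitt_ideal_def)

lemma ideal_zero: "0 \<in> I"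
  using additive_subgroup.zero_closed[OF ideal.axioms(1)[OF ideal_leavitt_ideal]] by simp

lemma ideal_add: "a \<in> I \<Longrightarrow> b \<in> I \<Longrightarrow> a + b \<in> I"
  using additive_subgroup.a_closed[OF ideal.axioms(1)[OF ideal_leavitt_ideal], of a b] by simp

lemma ideal_uminus: "a \<in> I \<Longrightarrow> - a \<in> I"
  using additive_subgroup.a_inv_closed[OF ideal.axioms(1)[OF ideal_leavitt_ideal], of a]
  by (simp add: a_inv_free_algebra ideal_subset)

lemma ideal_diff: "a \<in> I \<Longrightarrow> b \<in> I \<Longrightarrow> a - b \<in> I"
  using ideal_add[OF _ ideal_uminus, of a b] by simp

lemma ideal_sum: "(\<And>i. i \<in> S \<Longrightarrow> a i \<in> I) \<Longrightarrow> (\<Sum>i\<in>S. a i) \<in> I"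
  by (induction S rule: infinite_finite_induct) (auto intro: ideal_zero ideal_add)

lemma ideal_mult_left: "a \<in> I \<Longrightarrow> b \<in> carrier A \<Longrightarrow> b * a \<in> I"
  using ideal.I_l_closed[OF ideal_leavitt_ideal, of a b] by simp

lemma ideal_mult_right: "a \<in> I \<Longrightarrow> b \<in> carrier A \<Longrightarrow> a * b \<in> I"
  using ideal.I_r_closed[OF ideal_leavitt_ideal, of a b] by simp

lemma carrier_F:
  "a \<in> carrier F \<longleftrightarrow>
     a \<in> carrier A \<and> (\<forall>w \<in> Poly_Mapping.keys a. letters w \<noteq> [])"
  by (simp add: free_nonunital_algebra_def)

lemma carrier_F_imp: "a \<in> carrier F \<Longrightarrow> a \<in> carrier A"
  by (simp add: carrier_F)

lemma F_closed:
  assumes "a \<in> carrier F" "b \<in> carrier F"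
  shows "a + b \<in> carrier F" "a * b \<in> carrier F"
  using assms Poly_Mapping.keys_add[of a b] keys_mult[of a b]
  by (fastforce simp: carrier_F free_algebra_closed plus_word_def)+

lemma F_zero_closed: "0 \<in> carrier F"
  by (simp add: carrier_F carrier_free_algebra)

lemma mem_leavitt_class: "b \<in> leavitt_class a \<longleftrightarrow> b - a \<in> I"
proof -
  have "b \<in> leavitt_class a \<longleftrightarrow> (\<exists>i\<in>I. b = i + a)"
    by (auto simp: leavitt_class_def a_r_coset_def r_coset_def free_nonunital_algebra_def)
  also have "\<dots> \<longleftrightarrow> b - a \<in> I"
    by (auto intro!: bexI[of _ "b - a"])
  finally show ?thesis .
qed

lemma leavitt_class_eq_iff: "leavitt_class a = leavitt_class b \<longleftrightarrow> a - b \<in> I"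
proof
  assume "leavitt_class a = leavitt_class b"
  moreover have "a \<in> leavitt_class a"
    by (simp add: mem_leavitt_class ideal_zero)
  ultimately show "a - b \<in> I"
    by (simp add: mem_leavitt_class)
next
  assume ab: "a - b \<in> I"
  show "leavitt_class a = leavitt_class b"
    using ideal_add[OF _ ab] ideal_diff[OF _ ab] by (fastforce simp: mem_leavitt_class)
qed

lemma carrier_L: "carrier L = leavitt_class ` carrier F"
  by (auto simp: leavitt_path_algebra_def ring.defs module.defs FactRing_def A_RCOSETS_def
      RCOSETS_def leavitt_class_def a_r_coset_def Let_def)

lemma L_zero: "\<zero>\<^bsub>L\<^esub> = leavitt_class 0"
  by (auto simp: leavitt_path_algebra_def ring.defs module.defs FactRing_def Let_def
      mem_leavitt_class)

lemma L_add: "leavitt_class a \<oplus>\<^bsub>L\<^esub> leavitt_class b = leavitt_class (a + b)"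
proof -
  have "leavitt_class a \<oplus>\<^bsub>L\<^esub> leavitt_class b = (\<Union>x\<in>leavitt_class a. \<Union>y\<in>leavitt_class b. {x + y})"
    by (simp add: leavitt_path_algebra_def ring.defs module.defs FactRing_def Let_def
        set_add_def set_mult_def free_nonunital_algebra_def)
  also have "\<dots> = leavitt_class (a + b)"
  proof (intro equalityI subsetI)
    fix z assume "z \<in> (\<Union>x\<in>leavitt_class a. \<Union>y\<in>leavitt_class b. {x + y})"
    then show "z \<in> leavitt_class (a + b)"
      using ideal_add by (fastforce simp: mem_leavitt_class algebra_simps)
  next
    fix z assume "z \<in> leavitt_class (a + b)"
    then have "z - b \<in> leavitt_class a" "b \<in> leavitt_class b"
      by (simp_all add: mem_leavitt_class algebra_simps ideal_zero)
    then show "z \<in> (\<Union>x\<in>leavitt_class a. \<Union>y\<in>leavitt_class b. {x + y})"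
      by force
  qed
  finally show ?thesis .
qed

lemma L_mult:
  assumes "a \<in> carrier F" "b \<in> carrier F"
  shows "leavitt_class a \<otimes>\<^bsub>L\<^esub> leavitt_class b = leavitt_class (a * b)"
proof -
  have "leavitt_class a \<otimes>\<^bsub>L\<^esub> leavitt_class b = (\<Union>x\<in>leavitt_class a. \<Union>y\<in>leavitt_class b. leavitt_class (x * y))"
    by (simp add: leavitt_path_algebra_def ring.defs module.defs FactRing_def Let_def
        rcoset_mult_def free_nonunital_algebra_def leavitt_class_def)
  also have "\<dots> = (\<Union>x\<in>leavitt_class a. \<Union>y\<in>leavitt_class b. leavitt_class (a * b))"
  proof (intro SUP_cong refl)
    fix x y assume "x \<in> leavitt_class a" "y \<in> leavitt_class b"
    then have d: "x - a \<in> I" "y - b \<in> I"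
      by (simp_all add: mem_leavitt_class)
    have "x \<in> carrier A"
      using free_algebra_closed(1)[OF ideal_subset[OF d(1)] carrier_F_imp[OF assms(1)]] by simp
    moreover have "x * y - a * b = x * (y - b) + (x - a) * b"
      by (simp add: algebra_simps)
    ultimately show "leavitt_class (x * y) = leavitt_class (a * b)"
      using d assms by (simp add: leavitt_class_eq_iff ideal_add ideal_mult_left ideal_mult_right carrier_F_imp)
  qed
  also have "\<dots> = leavitt_class (a * b)"
    using mem_leavitt_class[of a a] mem_leavitt_class[of b b] ideal_zero by auto
  finally show ?thesis .
qed

lemma abelian_monoid_L: "abelian_monoid L"
  by (rule abelian_monoidI)
    (auto simp: carrier_L L_zero L_add ac_simps intro!: imageI F_closed F_zero_closed)

text \<open>The vertex that fixes a letter from the left; for a ghost edge this is the range.\<close>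

fun source :: "('a, 'b) generator \<Rightarrow> 'a" where
  "source (Vert v) = v"
| "source (Edge e) = tail G e"
| "source (Ghost e) = head G e"

lemma source_in_verts: "x \<in> generators G \<Longrightarrow> source x \<in> verts G"
  by (auto simp: generators_def)

lemma source_mult: "x \<in> generators G \<Longrightarrow> ncvar (Vert (source x)) * ncvar x - ncvar x \<in> I"
  by (auto simp: generators_def intro!: relator_in_ideal
      intro: leavitt_relators.intros leavitt_relators.vertices[of v G v for v, simplified])

lemma ncvar_in_carrier_F: "x \<in> generators G \<Longrightarrow> ncvar x \<in> carrier F"
  by (simp add: carrier_F ncvar_in_carrier) (simp add: ncvar_def)

lemma vertex_mult:
  assumes v: "v \<in> verts G" and x: "x \<in> generators G"
  shows "ncvar (Vert v) * ncvar x - (if v = source x then ncvar x else 0) \<in> I"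
proof -
  let ?s = "ncvar (Vert (source x)) :: (_, 'k::field) ncpoly" and ?v = "ncvar (Vert v) :: (_, 'k::field) ncpoly"
    and ?x = "ncvar x :: (_, 'k::field) ncpoly" and ?C = "carrier A"
  have mem: "?v \<in> ?C" "?x \<in> ?C"
    using v x by (auto intro!: ncvar_in_carrier simp: generators_def)
  have "?v * ?s - (if v = source x then ?s else 0) \<in> I"
    by (intro relator_in_ideal leavitt_relators.vertices v source_in_verts x)
  from ideal_mult_right[OF this mem(2)] ideal_mult_left[OF source_mult[OF x] mem(1)]
  \<comment> \<open>This difference is \<open>v x\<close> when \<open>v\<close> is not the source of \<open>x\<close>, by associativity.\<close>
  have *: "(?v * ?s - (if v = source x then ?s else 0)) * ?x - ?v * (?s * ?x - ?x) \<in> I"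
    by (rule ideal_diff)
  show ?thesis
  proof (cases "v = source x")
    case True
    then show ?thesis
      using source_mult[OF x] by simp
  next
    case False
    then show ?thesis
      using * by (simp add: algebra_simps)
  qed
qed

text \<open>
  The vertex that fixes the first letter of a word fixes the word, and all other vertices kill it.
  So one finite sum of vertices serves all words of \<open>a\<close> at once.
\<close>

lemma vertex_sum_left_unit:
  assumes T: "finite T" "T \<subseteq> verts G"
    and a: "a \<in> carrier F" "\<And>w. w \<in> Poly_Mapping.keys a \<Longrightarrow> source (hd (letters w)) \<in> T"
  shows "(\<Sum>v\<in>T. ncvar (Vert v)) * a - a \<in> I"
proof -
  let ?f = "\<Sum>v\<in>T. ncvar (Vert v) :: (_, 'k::field) ncpoly"
  let ?s = "\<lambda>w. Poly_Mapping.single w (Poly_Mapping.lookup a w)"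
  have "?f * ?s w - ?s w \<in> I" if w: "w \<in> Poly_Mapping.keys a" for w
  proof -
    obtain x u where xu: "letters w = x # u" "x \<in> generators G" "set u \<subseteq> generators G"
      using a(1) w by (cases "letters w") (auto simp: carrier_F carrier_free_algebra)
    let ?u = "Poly_Mapping.single (Word u) (Poly_Mapping.lookup a w)"
    have "w = Word [x] + Word u"
      using xu by (cases w) (simp add: plus_word_def)
    then have s: "?s w = ncvar x * ?u"
      by (simp add: ncvar_def mult_single)
    have "source x \<in> T"
      using a(2)[OF w] xu by simp
    then have "?f * ncvar x - ncvar x
        = (\<Sum>v\<in>T. ncvar (Vert v) * ncvar x - (if v = source x then ncvar x else 0))"
      using T by (simp add: sum_subtractf sum_distrib_right)
    also have "\<dots> \<in> I"
      using T xu by (intro ideal_sum vertex_mult) auto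
    finally have "(?f * ncvar x - ncvar x) * ?u \<in> I"
      using xu by (intro ideal_mult_right) (auto simp: carrier_free_algebra)
    then show ?thesis
      by (simp add: s algebra_simps)
  qed
  then have "(\<Sum>w\<in>Poly_Mapping.keys a. ?f * ?s w - ?s w) \<in> I"
    by (rule ideal_sum)
  moreover have "(\<Sum>w\<in>Poly_Mapping.keys a. ?f * ?s w - ?s w) = ?f * a - a"
    unfolding sum_subtractf sum_distrib_left[symmetric]
    by (simp only: ncpoly_eq_sum_single[symmetric])
  ultimately show ?thesis
    by simp
qed

lemma vertex_sum_in_carrier: "T \<subseteq> verts G \<Longrightarrow> (\<Sum>v\<in>T. ncvar (Vert v) :: (_, 'k::field) ncpoly) \<in> carrier F"
proof (induction T rule: infinite_finite_induct)
  case (insert v T)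
  then have "(ncvar (Vert v) :: (_, 'k) ncpoly) \<in> carrier F"
    by (intro ncvar_in_carrier_F) (simp add: generators_def)
  then show ?case
    using insert by (simp add: F_closed)
qed (simp_all add: F_zero_closed)

lemma L_left_local_unit:
  assumes "finite S" "S \<subseteq> carrier L"
  shows "\<exists>f \<in> carrier L. \<forall>s \<in> S. f \<otimes>\<^bsub>L\<^esub> s = s"
proof -
  obtain S' where S': "finite S'" "S' \<subseteq> carrier F" "S = leavitt_class ` S'"
    using assms finite_subset_image[of S leavitt_class "carrier F"] by (auto simp: carrier_L)
  define T where "T = (\<Union>a\<in>S'. (\<lambda>w. source (hd (letters w))) ` Poly_Mapping.keys a)"
  have T: "finite T" "T \<subseteq> verts G"
    using S' by (auto simp: T_def carrier_F carrier_free_algebra subset_iff intro!: source_in_verts)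
  let ?f = "\<Sum>v\<in>T. ncvar (Vert v) :: (_, 'k::field) ncpoly"
  have f: "?f \<in> carrier F"
    by (rule vertex_sum_in_carrier[OF T(2)])
  have "leavitt_class ?f \<otimes>\<^bsub>L\<^esub> leavitt_class a = leavitt_class a" if "a \<in> S'" for a
  proof -
    have "?f * a - a \<in> I"
      using that S' by (intro vertex_sum_left_unit[OF T]) (auto simp: T_def)
    then show ?thesis
      using L_mult[OF f, of a] that S' by (simp add: leavitt_class_eq_iff subset_iff)
  qed
  then show ?thesis
    using f S' by (auto simp: carrier_L)
qed

text \<open>
  The kernel of a matrix representation is an ideal, so it suffices to check the defining relations.
\<close>

lemma ideal_in_kernel:
  fixes M :: "('a, 'b) generator \<Rightarrow> 'x \<Rightarrow> 'x \<Rightarrow> 'k::field"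
  assumes X: "finite X"
    and rel: "\<And>a p q. a \<in> leavitt_relators G \<Longrightarrow> p \<in> X \<Longrightarrow> q \<in> X \<Longrightarrow> poly_matrix X M a p q = 0"
    and "a \<in> I" "p \<in> X" "q \<in> X"
  shows "poly_matrix X M a p q = 0"
proof -
  let ?A = "free_algebra (generators G) :: (('a, 'b) generator, 'k) ncpoly ring"
  let ?J = "{a \<in> carrier ?A. \<forall>p\<in>X. \<forall>q\<in>X. poly_matrix X M a p q = 0}"
  have "ideal ?J ?A"
  proof (rule idealI[OF ring_free_algebra])
    show "subgroup ?J (add_monoid ?A)"
    proof (rule subgroup.intro)
      fix a assume a: "a \<in> ?J"
      have "inv\<^bsub>add_monoid ?A\<^esub> a = - a"
        using a a_inv_free_algebra[of a "generators G"] by (simp only: a_inv_def) simp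
      then show "inv\<^bsub>add_monoid ?A\<^esub> a \<in> ?J"
        using a by (simp only: mem_Collect_eq poly_matrix_uminus)
          (simp add: carrier_free_algebra)
    qed (auto simp: poly_matrix_add free_algebra_closed carrier_free_algebra[of 0])
  qed (auto simp: poly_matrix_mult[OF X] free_algebra_closed)
  moreover have "leavitt_relators G \<subseteq> ?J"
    using leavitt_relators_subset[OF wf_digraph_axioms] rel by blast
  ultimately have "I \<subseteq> ?J"
    unfolding leavitt_ideal_def by (rule ring.genideal_minimal[OF ring_free_algebra])
  then show ?thesis
    using assms by blast
qed

end



section \<open>Branching systems\<close>

text \<open>
  The properties of a set of boundary paths that make it a basis of a representation: \<open>\<sigma>\<close> is the
  first vertex of a path and \<open>cons\<close> prepends an edge. Every edge prolongs every path starting at its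
  range, in an injective way, and a path that starts at a regular vertex has a first edge. The
  last property corresponds to the relation \<open>v = \<Sum> e e\<^sup>*\<close>, the injectivity to \<open>e\<^sup>* f = \<delta> r(e)\<close>.
\<close>

locale finite_branching_system = wf_digraph G for G :: "('v, 'e) pre_digraph" +
  fixes X :: "'x set" and cons :: "'e \<Rightarrow> 'x \<Rightarrow> 'x" and \<sigma> :: "'x \<Rightarrow> 'v"
  assumes finite_X: "finite X" and X_nonempty: "X \<noteq> {}"
    and \<sigma>_in_verts: "p \<in> X \<Longrightarrow> \<sigma> p \<in> verts G"
    and cons_closed: "e \<in> arcs G \<Longrightarrow> q \<in> X \<Longrightarrow> \<sigma> q = head G e \<Longrightarrow> cons e q \<in> X"
    and \<sigma>_cons: "e \<in> arcs G \<Longrightarrow> q \<in> X \<Longrightarrow> \<sigma> q = head G e \<Longrightarrow> \<sigma> (cons e q) = tail G e"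
    and cons_inject: "q \<in> X \<Longrightarrow> r \<in> X \<Longrightarrow> cons e q = cons f r \<Longrightarrow> e = f \<and> q = r"
    and cons_surj: "p \<in> X \<Longrightarrow> regular_vertex G (\<sigma> p) \<Longrightarrow>
      \<exists>e \<in> arcs G. \<exists>q \<in> X. \<sigma> q = head G e \<and> p = cons e q"
begin

text \<open>
  The positions of the entries 1 in the matrix of a generator, the image of the basis vector \<open>q\<close>
  being read off from column \<open>q\<close>. The matrix of a ghost edge is the transpose of that of the edge.
\<close>

fun generator_rel :: "('v, 'e) generator \<Rightarrow> 'x \<Rightarrow> 'x \<Rightarrow> bool" where
  "generator_rel (Vert v) p q \<longleftrightarrow> p = q \<and> \<sigma> q = v"
| "generator_rel (Edge e) p q \<longleftrightarrow> p = cons e q \<and> \<sigma> q = head G e"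
| "generator_rel (Ghost e) p q \<longleftrightarrow> q = cons e p \<and> \<sigma> p = head G e"

abbreviation generator_matrix :: "('v, 'e) generator \<Rightarrow> 'x \<Rightarrow> 'x \<Rightarrow> 'k::field" where
  "generator_matrix \<equiv> \<lambda>x p q. of_bool (generator_rel x p q)"

text \<open>
  Every generator acts as a partial injection of \<open>X\<close>, so no two nonzero terms meet when such
  matrices are multiplied, and the product is again a matrix of truth values.
\<close>

lemma generator_rel_functional:
  "generator_rel x p r \<Longrightarrow> generator_rel x p s \<Longrightarrow> r \<in> X \<Longrightarrow> s \<in> X \<Longrightarrow> r = s"
  using cons_inject by (cases x) auto

lemma sum_of_bool_unique:
  assumes "finite S" "\<And>r s. r \<in> S \<Longrightarrow> s \<in> S \<Longrightarrow> P r \<Longrightarrow> P s \<Longrightarrow> r = s"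
  shows "(\<Sum>r\<in>S. of_bool (P r)) = (of_bool (\<exists>r\<in>S. P r) :: 'k::field)"
proof (cases "\<exists>r\<in>S. P r")
  case True
  then obtain r where r: "r \<in> S" "P r"
    by blast
  then have "(\<Sum>r\<in>S. of_bool (P r)) = (\<Sum>s\<in>{r}. of_bool (P s) :: 'k)"
    using assms by (intro sum.mono_neutral_right) auto
  then show ?thesis
    using r by auto
qed auto

lemma poly_matrix_product:
  assumes "p \<in> X" "q \<in> X"
  shows "poly_matrix X generator_matrix (ncvar x * ncvar y) p q
    = of_bool (\<exists>r\<in>X. generator_rel x p r \<and> generator_rel y r q)"
proof -
  have "poly_matrix X generator_matrix (ncvar x * ncvar y) p q
      = (\<Sum>r\<in>X. of_bool (generator_rel x p r \<and> generator_rel y r q))"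
    using assms finite_X by (simp add: poly_matrix_mult poly_matrix_ncvar of_bool_conj)
  then show ?thesis
    using generator_rel_functional finite_X by (subst (asm) sum_of_bool_unique) blast+
qed

lemma relator_matrix_eq_zero:
  assumes "a \<in> leavitt_relators G" and p: "p \<in> X" and q: "q \<in> X"
  shows "poly_matrix X generator_matrix a p q = 0"
  using assms(1)
proof cases
  case (vertices v w)
  then show ?thesis
    using p q by (auto simp: poly_matrix_diff poly_matrix_product poly_matrix_ncvar finite_X)
next
  case (edge_source e)
  then show ?thesis
    using p q \<sigma>_cons by (auto simp: poly_matrix_diff poly_matrix_product poly_matrix_ncvar finite_X)
next
  case (edge_range e)
  then show ?thesis
    using p q by (auto simp: poly_matrix_diff poly_matrix_product poly_matrix_ncvar finite_X)
next
  case (ghost_range e)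
  then show ?thesis
    using p q by (auto simp: poly_matrix_diff poly_matrix_product poly_matrix_ncvar finite_X)
next
  case (ghost_source e)
  then show ?thesis
    using p q \<sigma>_cons by (auto simp: poly_matrix_diff poly_matrix_product poly_matrix_ncvar finite_X)
next
  case (CK1 e f)
  then show ?thesis
    using p q cons_inject cons_closed
    by (auto simp: poly_matrix_diff poly_matrix_product poly_matrix_ncvar finite_X)
next
  case (CK2 v)
  let ?P = "\<lambda>e. \<exists>r\<in>X. (p = cons e r \<and> \<sigma> r = head G e) \<and> q = cons e r \<and> \<sigma> r = head G e"
  have "(\<exists>e\<in>out_arcs G v. ?P e) \<longleftrightarrow> p = q \<and> \<sigma> q = v"
  proof
    assume "\<exists>e\<in>out_arcs G v. ?P e"
    then show "p = q \<and> \<sigma> q = v"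
      using \<sigma>_cons by (auto simp: in_out_arcs_conv)
  next
    assume "p = q \<and> \<sigma> q = v"
    then obtain e r where "e \<in> arcs G" "r \<in> X" "\<sigma> r = head G e" "p = cons e r" "p = q" "\<sigma> q = v"
      using cons_surj[OF p] CK2 by auto
    then show "\<exists>e\<in>out_arcs G v. ?P e"
      using \<sigma>_cons by (intro bexI[of _ e]) (auto simp: in_out_arcs_conv)
  qed
  moreover have "(\<Sum>e\<in>out_arcs G v. of_bool (?P e)) = (of_bool (\<exists>e\<in>out_arcs G v. ?P e) :: 'a)"
    using CK2 cons_inject by (intro sum_of_bool_unique) (auto simp: regular_vertex_def)
  ultimately show ?thesis
    using p q CK2
    by (simp add: poly_matrix_diff poly_matrix_sum poly_matrix_product poly_matrix_ncvar finite_X)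
qed

text \<open>
  All members of a coset of the ideal have the same entries in \<open>X\<close>, so the choice is immaterial.
\<close>

definition coset_matrix :: "('v, 'e, 'k::field) leavitt_elem \<Rightarrow> 'x \<Rightarrow> 'x \<Rightarrow> 'k" where
  "coset_matrix c = poly_matrix X generator_matrix (SOME a. a \<in> c)"

lemma coset_matrix_leavitt_class:
  assumes "p \<in> X" "q \<in> X"
  shows "coset_matrix (leavitt_class a) p q = poly_matrix X generator_matrix a p q"
proof -
  have "a \<in> leavitt_class a"
    by (simp add: mem_leavitt_class ideal_zero)
  then have "(SOME b. b \<in> leavitt_class a) \<in> leavitt_class a"
    by (rule someI)
  then have "poly_matrix X generator_matrix ((SOME b. b \<in> leavitt_class a) - a) p q = 0"
    using ideal_in_kernel[OF finite_X relator_matrix_eq_zero] assms by (simp add: mem_leavitt_class)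
  then show ?thesis
    by (simp add: coset_matrix_def poly_matrix_diff)
qed

text \<open>
  The sum of the finitely many vertices at which a path of \<open>X\<close> starts acts as the identity: every
  path is fixed by its own starting vertex and killed by the others.
\<close>

lemma locally_unital_representation_coset_matrix:
  "locally_unital_representation
     (leavitt_path_algebra G :: ('k::field, ('v, 'e, 'k) leavitt_elem) module) X coset_matrix"
proof (rule locally_unital_representation.intro)
  let ?L = "leavitt_path_algebra G :: ('k::field, ('v, 'e, 'k) leavitt_elem) module"
  show "abelian_monoid ?L"
    by (rule abelian_monoid_L)
  show "a \<otimes>\<^bsub>?L\<^esub> b \<in> carrier ?L" if "a \<in> carrier ?L" "b \<in> carrier ?L" for a b
    using that by (auto simp: carrier_L L_mult F_closed)
  show "\<zero>\<^bsub>?L\<^esub> \<otimes>\<^bsub>?L\<^esub> a = \<zero>\<^bsub>?L\<^esub>" if "a \<in> carrier ?L" for a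
    using that by (auto simp: carrier_L L_mult L_zero F_zero_closed)
  show "\<exists>f\<in>carrier ?L. \<forall>s\<in>S. f \<otimes>\<^bsub>?L\<^esub> s = s" if "finite S" "S \<subseteq> carrier ?L" for S
    using that by (rule L_left_local_unit)
  show "finite X" "X \<noteq> {}"
    by (rule finite_X X_nonempty)+
  show "coset_matrix (a \<oplus>\<^bsub>?L\<^esub> b) p q = coset_matrix a p q + coset_matrix b p q"
    if "a \<in> carrier ?L" "b \<in> carrier ?L" "p \<in> X" "q \<in> X" for a b p q
    using that by (auto simp: carrier_L L_add coset_matrix_leavitt_class poly_matrix_add)
  show "coset_matrix (a \<otimes>\<^bsub>?L\<^esub> b) p q = (\<Sum>r\<in>X. coset_matrix a p r * coset_matrix b r q)"
    if "a \<in> carrier ?L" "b \<in> carrier ?L" "p \<in> X" "q \<in> X" for a b p q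
    using that
    by (auto simp: carrier_L L_mult coset_matrix_leavitt_class poly_matrix_mult finite_X)
  let ?e = "\<Sum>v\<in>\<sigma> ` X. ncvar (Vert v) :: (_, 'k) ncpoly"
  have "leavitt_class ?e \<in> carrier ?L"
    using \<sigma>_in_verts by (auto simp: carrier_L intro!: vertex_sum_in_carrier imageI)
  moreover have "coset_matrix (leavitt_class ?e) p q = of_bool (p = q)" if "p \<in> X" "q \<in> X" for p q
  proof -
    have "coset_matrix (leavitt_class ?e) p q = (\<Sum>v\<in>\<sigma> ` X. of_bool (p = q \<and> \<sigma> q = v))"
      using that by (simp add: coset_matrix_leavitt_class poly_matrix_sum poly_matrix_ncvar finite_X)
    also have "\<dots> = of_bool (\<exists>v\<in>\<sigma> ` X. p = q \<and> \<sigma> q = v)"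
      using finite_X by (intro sum_of_bool_unique) auto
    finally show ?thesis
      using that by auto
  qed
  ultimately show "\<exists>e\<in>carrier ?L. \<forall>p\<in>X. \<forall>q\<in>X. coset_matrix e p q = of_bool (p = q)"
    by blast
qed

theorem gr_IBN_leavitt_path_algebra:
  "gr_IBN (leavitt_path_algebra G :: ('k::field, ('v, 'e, 'k) leavitt_elem) module)
     (leavitt_component G)"
  by (rule locally_unital_representation.gr_IBN_of_representation
      [OF locally_unital_representation_coset_matrix])

end


section \<open>Boundary paths\<close>

context wf_digraph
begin

text \<open>
  The way back to the tail of \<open>e\<close> can be shortened to a path without repeated vertices.
\<close>

lemma cycle_through_arc:
  assumes "e \<in> arcs G" "awalk (head G e) p (tail G e)"
  shows "\<exists>q. cycle (e # q)"
proof -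
  have "apath (head G e) (awalk_to_apath p) (tail G e)"
    using assms(2) by (rule apath_awalk_to_apath)
  then have "cycle (e # awalk_to_apath p)"
    using assms(1) by (auto simp: cycle_def apath_def awalk_Cons_iff intro!: exI[of _ "tail G e"])
  then show ?thesis ..
qed

lemma awalk_verts_subset_predecessors:
  assumes "awalk w p v"
  shows "set (awalk_verts w p) \<subseteq> predecessors G v"
proof
  fix u assume "u \<in> set (awalk_verts w p)"
  then obtain q where "awalk u q v"
    using awalk_decomp[OF assms] by blast
  then show "u \<in> predecessors G v"
    using awalk_hd_in_verts by (auto simp: predecessors_def path_from_to_def)
qed

lemma predecessors_closed:
  assumes "e \<in> arcs G" "head G e \<in> predecessors G v"
  shows "tail G e \<in> predecessors G v"
  using assms awalk_Cons_iff[of "tail G e" e] by (auto simp: predecessors_def path_from_to_def)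

lemma finite_out_arcs_predecessors:
  assumes "row_finite G" "finite P" "P \<subseteq> verts G"
  shows "finite (\<Union>w\<in>P. out_arcs G w)"
  using assms by (auto simp: row_finite_def)

text \<open>
  A walk that returns to its first vertex \<open>w\<close> yields a cycle through \<open>w\<close>, and \<open>w\<close> still leads
  to \<open>v\<close>, contrary to maximality.
\<close>

lemma distinct_awalk_verts_to_maximal_sink:
  assumes v: "maximal_sink G v" and "awalk w p v"
  shows "distinct (awalk_verts w p)"
  using assms(2)
proof (induction p arbitrary: w)
  case (Cons e p)
  then have e: "e \<in> arcs G" "tail G e = w" "awalk (head G e) p v"
    by (auto simp: awalk_Cons_iff)
  have "w \<notin> set (awalk_verts (head G e) p)"
  proof
    assume "w \<in> set (awalk_verts (head G e) p)"
    then obtain q where "awalk (head G e) q (tail G e)"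
      using awalk_decomp[OF e(3)] e(2) by blast
    then obtain c where "cycle (e # c)"
      using cycle_through_arc[OF e(1)] by blast
    moreover have "cycle_to_vertex G (e # c) v"
      using Cons.prems e(2) by (auto simp: cycle_to_vertex_def cycle_verts_def path_from_to_def)
    ultimately show False
      using v by (auto simp: maximal_sink_def)
  qed
  then show ?case
    using Cons.IH e by simp
qed simp

text \<open>
  The basis for a sink \<open>v\<close>. The path of length 0 also starts at \<open>v\<close>, which is why \<open>v\<close> is appended
  to the list of tails. It has no first edge, but then a sink is not regular. A path that does
  not repeat vertices has fewer edges than \<open>v\<close> has predecessors, and its edges come from the
  finitely many edges that leave predecessors.
\<close>

lemma finite_branching_system_sink:
  assumes "row_finite G" and v: "maximal_sink G v" and P: "finite (predecessors G v)"
  shows "finite_branching_system G {p. \<exists>w. awalk w p v} (#) (\<lambda>p. hd (map (tail G) p @ [v]))"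
proof
  let ?X = "{p. \<exists>w. awalk w p v}" and ?\<sigma> = "\<lambda>p. hd (map (tail G) p @ [v])"
  have sink: "v \<in> verts G" "out_arcs G v = {}"
    using v by (auto simp: maximal_sink_def sink_def)
  have \<sigma>: "?\<sigma> p = w" "w \<in> verts G" if "awalk w p v" for w p
    using that by (cases p; auto simp: awalk_Nil_iff awalk_Cons_iff)+
  show "finite ?X"
  proof (rule finite_subset)
    let ?A = "\<Union>w\<in>predecessors G v. out_arcs G w"
    show "?X \<subseteq> {p. set p \<subseteq> ?A \<and> length p \<le> card (predecessors G v)}"
    proof safe
      fix p w assume p: "awalk w p v"
      have sub: "set (awalk_verts w p) \<subseteq> predecessors G v"
        by (rule awalk_verts_subset_predecessors[OF p])
      show "e \<in> ?A" if "e \<in> set p" for e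
        using that p sub awalk_verts_arc1[OF that, of w] by (auto simp: in_out_arcs_conv awalk_def)
      have "card (set (awalk_verts w p)) = Suc (length p)"
        using distinct_awalk_verts_to_maximal_sink[OF v p]
        by (simp add: distinct_card length_awalk_verts)
      then show "length p \<le> card (predecessors G v)"
        using card_mono[OF P sub] by simp
    qed
    show "finite {p. set p \<subseteq> ?A \<and> length p \<le> card (predecessors G v)}"
      using finite_out_arcs_predecessors[OF assms(1) P]
      by (intro finite_lists_length_le) (auto simp: predecessors_def)
  qed
  show "?X \<noteq> {}"
    using sink awalk_Nil_iff by blast
  show "?\<sigma> p \<in> verts G" if "p \<in> ?X" for p
    using that \<sigma> by auto
  show "e # q \<in> ?X" if "e \<in> arcs G" "q \<in> ?X" "?\<sigma> q = head G e" for e q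
  proof -
    have "awalk (head G e) q v"
      using that \<sigma> by auto
    then show ?thesis
      using that(1) by (auto simp: awalk_Cons_iff)
  qed
  show "\<exists>e\<in>arcs G. \<exists>q\<in>?X. ?\<sigma> q = head G e \<and> p = e # q"
    if "p \<in> ?X" "regular_vertex G (?\<sigma> p)" for p
  proof (cases p)
    case Nil
    then show ?thesis
      using that sink by (simp add: regular_vertex_def)
  next
    case (Cons e q)
    then show ?thesis
      using that \<sigma> by (auto simp: awalk_Cons_iff)
  qed
qed auto

lemma awalk_infinite_path_segment:
  assumes x: "\<And>i. x i \<in> arcs G" "\<And>i. head G (x i) = tail G (x (Suc i))"
  shows "awalk (tail G (x a)) (map x [a..<a + n]) (tail G (x (a + n)))"
proof (induction n arbitrary: a)
  case 0
  then show ?case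
    using x(1) by (auto simp: awalk_Nil_iff)
next
  case (Suc n)
  have "map x [a..<a + Suc n] = x a # map x [Suc a..<Suc a + n]"
    by (simp add: upt_rec)
  then show ?case
    using Suc[of "Suc a"] x by (simp add: awalk_Cons_iff)
qed

context
  fixes c
  assumes c: "maximal_cycle G c"
begin

text \<open>
  An edge that lies on some closed walk lies on a cycle. If this cycle leads to \<open>c\<close>, then by
  maximality it is \<open>c\<close> up to rotation.
\<close>

lemma arc_to_predecessor_on_maximal_cycle:
  assumes "e \<in> arcs G" "awalk (head G e) p (tail G e)" "tail G e \<in> cycle_predecessors G c"
  shows "e \<in> set c"
proof -
  obtain d where d: "cycle (e # d)"
    using cycle_through_arc[OF assms(1,2)] by blast
  have "cycle_to_cycle G (e # d) c"
    using assms(3)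
    by (auto simp: cycle_to_cycle_def cycle_verts_def cycle_predecessors_def predecessors_def)
  then obtain n where "e # d = rotate n c"
    using c d by (auto simp: maximal_cycle_def)
  then show ?thesis
    by (metis list.set_intros(1) set_rotate)
qed

lemma cycle_verts_subset_predecessors: "cycle_verts G c \<subseteq> cycle_predecessors G c"
proof
  fix u assume u: "u \<in> cycle_verts G c"
  then have "u \<in> verts G"
    using c by (auto simp: cycle_verts_def maximal_cycle_def cycle_def awalk_def)
  then have "u \<in> predecessors G u"
    using awalk_Nil_iff by (auto simp: predecessors_def path_from_to_def)
  then show "u \<in> cycle_predecessors G c"
    using u by (auto simp: cycle_predecessors_def)
qed

lemma cycle_awalk_between:
  assumes "u \<in> cycle_verts G c" "w \<in> cycle_verts G c"
  shows "\<exists>p. awalk u p w"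
proof -
  obtain z where z: "awalk z c z"
    using c by (auto simp: maximal_cycle_def cycle_def)
  have "y \<in> set (awalk_verts z c)" if "y \<in> cycle_verts G c" for y
    using that awalk_verts_arc1[of _ c z] by (auto simp: cycle_verts_def)
  then obtain p q where "awalk u p z" "awalk z q w"
    using assms awalk_decomp[OF z] by metis
  then show ?thesis
    using awalk_appendI by blast
qed

text \<open>
  From the range of \<open>e\<close> one gets back to \<open>c\<close> and along \<open>c\<close> to the tail of \<open>e\<close>, so \<open>e\<close> lies on a
  closed walk.
\<close>

lemma no_exit_from_maximal_cycle:
  assumes "e \<in> arcs G" "tail G e \<in> cycle_verts G c" "head G e \<in> cycle_predecessors G c"
  shows "e \<in> set c"
proof -
  obtain u p where "u \<in> cycle_verts G c" "awalk (head G e) p u"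
    using assms(3) by (auto simp: cycle_predecessors_def predecessors_def path_from_to_def)
  then obtain q where "awalk (head G e) q (tail G e)"
    using cycle_awalk_between[OF _ assms(2)] awalk_appendI by blast
  moreover have "tail G e \<in> cycle_predecessors G c"
    using assms(2) cycle_verts_subset_predecessors by blast
  ultimately show ?thesis
    using arc_to_predecessor_on_maximal_cycle assms(1) by blast
qed

lemma inj_on_tail_cycle: "inj_on (tail G) (set c)"
proof -
  obtain u where u: "awalk u c u" "distinct (tl (awalk_verts u c))" "c \<noteq> []"
    using c by (auto simp: maximal_cycle_def cycle_def)
  obtain e d where ed: "c = e # d"
    using u(3) by (cases c) auto
  have "head G (last c) = u"
    using awlast_of_awalk[OF u(1)] u(3) by (simp add: awalk_verts_conv)
  then have "distinct (map (tail G) d @ [u])"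
    using u(2) ed by (simp add: awalk_verts_conv split: if_splits)
  moreover have "tail G e = u"
    using u(1) ed by (simp add: awalk_Cons_iff)
  ultimately have "distinct (map (tail G) c)"
    using ed by auto
  then show ?thesis
    by (simp add: distinct_map)
qed

text \<open>
  Only the tails are required to be predecessors of the cycle, as every range is the tail of the
  next edge. The next lemmas show that every such path finally runs around the cycle.
\<close>

definition infinite_paths :: "(nat \<Rightarrow> 'b) set" where
  "infinite_paths = {x. \<forall>i. x i \<in> arcs G \<and> tail G (x i) \<in> cycle_predecessors G c \<and>
     head G (x i) = tail G (x (Suc i))}"

text \<open>
  Among more tails than there are predecessors some vertex is repeated. The first edge after its
  earlier occurrence lies on a closed walk, hence on \<open>c\<close>.
\<close>

lemma infinite_path_enters_cycle:
  assumes P: "finite (cycle_predecessors G c)" and x: "x \<in> infinite_paths"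
  shows "\<exists>i \<le> card (cycle_predecessors G c). x i \<in> set c"
proof -
  let ?P = "cycle_predecessors G c"
  have "\<not> inj_on (\<lambda>i. tail G (x i)) {..card ?P}"
  proof
    assume "inj_on (\<lambda>i. tail G (x i)) {..card ?P}"
    then have "card {..card ?P} \<le> card ?P"
      using x by (intro card_inj_on_le[OF _ _ P]) (auto simp: infinite_paths_def)
    then show False
      by simp
  qed
  then obtain i j where ij: "i < j" "j \<le> card ?P" "tail G (x i) = tail G (x j)"
    by (auto simp: inj_on_def) (metis linorder_neqE_nat)
  obtain n where n: "j = Suc i + n"
    using ij(1) less_iff_Suc_add by auto
  have "awalk (head G (x i)) (map x [Suc i..<Suc i + n]) (tail G (x i))"
    using awalk_infinite_path_segment[of x "Suc i" n] x ij n by (simp add: infinite_paths_def)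
  then have "x i \<in> set c"
    using x by (intro arc_to_predecessor_on_maximal_cycle) (auto simp: infinite_paths_def)
  then show ?thesis
    using ij by (intro exI[of _ i]) auto
qed

lemma infinite_path_stays_in_cycle:
  assumes x: "x \<in> infinite_paths" and "x i \<in> set c" "i \<le> k"
  shows "x k \<in> set c"
  using assms(3)
proof (induction k rule: dec_induct)
  case (step k)
  obtain u where u: "awalk u c u"
    using c by (auto simp: maximal_cycle_def cycle_def)
  have "head G (x k) \<in> set (awalk_verts u c)"
    using awalk_verts_arc2[OF u step.IH] .
  also have "\<dots> \<subseteq> cycle_verts G c"
    using u c awhd_of_awalk[OF u] awlast_of_awalk[OF u]
    by (cases c) (auto simp: awalk_verts_conv cycle_verts_def maximal_cycle_def cycle_def awalk_Cons_iff)
  finally have "tail G (x (Suc k)) \<in> cycle_verts G c"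
    using x by (simp add: infinite_paths_def)
  moreover have "head G (x (Suc k)) \<in> cycle_predecessors G c"
    using x by (simp add: infinite_paths_def)
  ultimately show ?case
    using x by (intro no_exit_from_maximal_cycle) (auto simp: infinite_paths_def)
qed (use assms in simp)

text \<open>
  The initial segment reaches \<open>c\<close>. From then on the path runs inside \<open>c\<close>, where the tail of an
  edge determines the edge.
\<close>

lemma infinite_paths_eqI:
  assumes x: "x \<in> infinite_paths" and y: "y \<in> infinite_paths"
    and P: "finite (cycle_predecessors G c)"
    and eq: "\<And>i. i \<le> card (cycle_predecessors G c) \<Longrightarrow> x i = y i"
  shows "x = y"
proof
  fix k
  obtain i where i: "i \<le> card (cycle_predecessors G c)" "x i \<in> set c"
    using infinite_path_enters_cycle[OF P x] by blast
  show "x k = y k"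
  proof (cases "i \<le> k")
    case True
    then show ?thesis
    proof (induction k rule: dec_induct)
      case (step k)
      have "tail G (x (Suc k)) = tail G (y (Suc k))"
        using step.IH x y by (auto simp: infinite_paths_def) metis
      moreover have "x (Suc k) \<in> set c" "y (Suc k) \<in> set c"
        using infinite_path_stays_in_cycle[OF x i(2)] infinite_path_stays_in_cycle[OF y, of i]
          i eq step.hyps by auto
      ultimately show ?case
        using inj_on_tail_cycle by (simp add: inj_on_def)
    qed (use i eq in simp)
  qed (use i eq in simp)
qed

lemma finite_infinite_paths:
  assumes "row_finite G" and P: "finite (cycle_predecessors G c)"
  shows "finite infinite_paths"
proof (rule inj_on_finite)
  let ?N = "Suc (card (cycle_predecessors G c))"
  let ?A = "\<Union>w\<in>cycle_predecessors G c. out_arcs G w"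
  show "inj_on (\<lambda>x. map x [0..<?N]) infinite_paths"
    by (intro inj_onI infinite_paths_eqI P) (auto simp: less_Suc_eq_le)
  show "(\<lambda>x. map x [0..<?N]) ` infinite_paths \<subseteq> {p. set p \<subseteq> ?A \<and> length p \<le> ?N}"
    by (auto simp: infinite_paths_def in_out_arcs_conv)
  show "finite {p. set p \<subseteq> ?A \<and> length p \<le> ?N}"
    using finite_out_arcs_predecessors[OF assms]
    by (intro finite_lists_length_le) (auto simp: cycle_predecessors_def predecessors_def)
qed

text \<open>The path that runs around \<open>c\<close> for ever is a member.\<close>

lemma infinite_paths_nonempty: "infinite_paths \<noteq> {}"
proof -
  obtain u where u: "awalk u c u" "c \<noteq> []"
    using c by (auto simp: maximal_cycle_def cycle_def)
  define x where "x i = c ! (i mod length c)" for i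
  have x_in: "x i \<in> set c" for i
    using u by (simp add: x_def)
  have arcs: "x i \<in> arcs G" for i
    using x_in u by (auto simp: awalk_def)
  have "tail G (x i) \<in> cycle_predecessors G c" for i
    using x_in cycle_verts_subset_predecessors by (auto simp: cycle_verts_def)
  moreover have "head G (x i) = tail G (x (Suc i))" for i
  proof -
    let ?k = "i mod length c"
    have k: "?k < length c"
      using u by simp
    have "awalk_verts u c ! Suc ?k = head G (c ! ?k)"
      using k u awalk_verts_conv'[of u c u] by (auto simp: awalk_def)
    moreover have "awalk_verts u c ! j = tail G (c ! j)" if "j < length c" for j
      using that u by (simp add: awalk_verts_conv nth_append)
    moreover have "awalk_verts u c ! length c = awalk_verts u c ! 0"
      using awhd_of_awalk[OF u(1)] awlast_of_awalk[OF u(1)]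
      by (simp add: hd_conv_nth last_conv_nth length_awalk_verts)
    moreover have "Suc ?k < length c \<or> Suc ?k = length c"
      using k by linarith
    ultimately show ?thesis
      using u by (auto simp: x_def mod_Suc)
  qed
  ultimately have "x \<in> infinite_paths"
    using arcs by (simp add: infinite_paths_def)
  then show ?thesis
    by blast
qed

lemma finite_branching_system_cycle:
  assumes "row_finite G" "finite (cycle_predecessors G c)"
  shows "finite_branching_system G infinite_paths case_nat (\<lambda>x. tail G (x 0))"
proof
  show "finite infinite_paths"
    by (rule finite_infinite_paths[OF assms])
  show "infinite_paths \<noteq> {}"
    by (rule infinite_paths_nonempty)
  show "tail G (x 0) \<in> verts G" if "x \<in> infinite_paths" for x
    using that by (simp add: infinite_paths_def)
  show "case_nat e x \<in> infinite_paths"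
    if e: "e \<in> arcs G" and x: "x \<in> infinite_paths" and "tail G (x 0) = head G e" for e x
  proof -
    have "tail G (x 0) \<in> cycle_predecessors G c"
      using x by (simp add: infinite_paths_def)
    then have "head G e \<in> cycle_predecessors G c"
      using that(3) by simp
    then have "tail G e \<in> cycle_predecessors G c"
      using predecessors_closed[OF e] by (auto simp: cycle_predecessors_def)
    then show ?thesis
      using that by (auto simp: infinite_paths_def split: nat.split)
  qed
  show "e = f \<and> x = y" if "case_nat e x = case_nat f y" for e f and x y :: "nat \<Rightarrow> 'b"
    using fun_cong[OF that, of 0] fun_cong[OF that, of "Suc _"] by auto
  show "\<exists>e\<in>arcs G. \<exists>y\<in>infinite_paths. tail G (y 0) = head G e \<and> x = case_nat e y"
    if "x \<in> infinite_paths" for x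
    using that
    by (intro bexI[of _ "x 0"] bexI[of _ "\<lambda>i. x (Suc i)"])
      (auto simp: infinite_paths_def fun_eq_iff split: nat.split)
qed auto

end

end

section \<open>Graded invariant basis number\<close>

theorem corollary2p5:
  fixes E :: "('v, 'e) pre_digraph"
  assumes "wf_digraph E"
    and "row_finite E"
    and "(\<exists>v. maximal_sink E v \<and> finite (predecessors E v)) \<or>
         (\<exists>c. maximal_cycle E c \<and> finite (cycle_predecessors E c))"
  shows "gr_IBN (leavitt_path_algebra E :: ('k::field, ('v, 'e, 'k) leavitt_elem) module)
                (leavitt_component E :: int \<Rightarrow> ('v, 'e, 'k) leavitt_elem set)"
  using assms(3)
proof (elim disjE exE conjE)
  fix v assume "maximal_sink E v" "finite (predecessors E v)"
  then show ?thesis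
    by (rule finite_branching_system.gr_IBN_leavitt_path_algebra
        [OF wf_digraph.finite_branching_system_sink[OF assms(1,2)]])
next
  fix c assume "maximal_cycle E c" "finite (cycle_predecessors E c)"
  then show ?thesis
    by (rule finite_branching_system.gr_IBN_leavitt_path_algebra
        [OF wf_digraph.finite_branching_system_cycle[OF assms(1) _ assms(2)]])
qed

end
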